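(* For $v\in L^2_{\mathbb{C}}(0,1)$, $\|v\|=1$, the non-local potential $\{\alpha,v\}$ can be recovered by the four spectra $\sigma(L_0)$, $\sigma(L_\alpha(v))$, $\sigma(L_\alpha(v+g))$ and $\sigma(L_\alpha(v+\mathrm{i}g))$, where $g(x)=1-x$.
   Context: Throughout, $\alpha\in\mathbb{R}$, and $\langle f,g\rangle=\int_0^1 f(x)\overline{g(x)}\,dx$, $\|f\|=\langle f,f\rangle^{1/2}$ on $L^2_{\mathbb{C}}(0,1)$. For $v\in L^2_{\mathbb{C}}(0,1)$, the self-adjoint operator $L_\alpha(v)$ in $L^2_{\mathbb{C}}(0,1)$ is $(L_\alpha(v)y)(x)=\mathrm{i}y'''(x)+\alpha\langle y,v\rangle v(x)$ with domain $\{y\in W_3^2(0,1): y(1)=y(0),\ y'(1)=y'(0),\ y''(1)=y''(0)\}$, where $W_3^2(0,1)$ is the Sobolev space of functions with three derivatives in $L^2$; $L_0$ is the operator $L_0y=\mathrm{i}y'''$ with the same domain. $\sigma(\cdot)$ denotes the spectrum.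
   Formalization: The spectra are taken with multiplicities, since the bare sets do not determine the potential; and for α = 0, where v has no effect on the operators, only α is recovered, while v is recovered (almost everywhere) when α ≠ 0. *)

theory Defs
  imports "HOL-Analysis.Analysis"
begin

abbreviation unit_leb :: "real measure" where
  "unit_leb \<equiv> lebesgue_on {0<..<1}"

text \<open>Elements of the complex Hilbert space on the unit interval are represented by functions;
  only their almost-everywhere class on the open unit interval matters.\<close>

definition L2 :: "(real \<Rightarrow> complex) set" where
  "L2 = {f. f \<in> borel_measurable unit_leb \<and> integrable unit_leb (\<lambda>x. (cmod (f x))\<^sup>2)}"

definition L2_inner :: "(real \<Rightarrow> complex) \<Rightarrow> (real \<Rightarrow> complex) \<Rightarrow> complex" where
  "L2_inner f g = (LINT x|unit_leb. f x * cnj (g x))"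

definition L2_norm :: "(real \<Rightarrow> complex) \<Rightarrow> real" where
  "L2_norm f = sqrt (Re (L2_inner f f))"

text \<open>The Sobolev space of functions with three square-integrable derivatives, in its
  one-dimensional description: \<open>u0\<close> is the continuous representative, \<open>u1\<close> and \<open>u2\<close> are its
  classical first and second derivatives on the closed interval (one-sided at the end points),
  and \<open>u2\<close> is absolutely continuous with almost-everywhere derivative \<open>u3\<close>.\<close>

definition W32 ::
  "(real \<Rightarrow> complex) \<Rightarrow> (real \<Rightarrow> complex) \<Rightarrow> (real \<Rightarrow> complex) \<Rightarrow> (real \<Rightarrow> complex) \<Rightarrow> bool" where
  "W32 u0 u1 u2 u3 \<longleftrightarrow>
     (\<forall>x\<in>{0..1}. (u0 has_vector_derivative u1 x) (at x within {0..1})) \<and>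
     (\<forall>x\<in>{0..1}. (u1 has_vector_derivative u2 x) (at x within {0..1})) \<and>
     u3 \<in> L2 \<and>
     (\<forall>x\<in>{0..1}. u2 x = u2 0 + (LINT t:{0<..<x}|lebesgue. u3 t))"

definition periodic_W32 ::
  "(real \<Rightarrow> complex) \<Rightarrow> (real \<Rightarrow> complex) \<Rightarrow> (real \<Rightarrow> complex) \<Rightarrow> (real \<Rightarrow> complex) \<Rightarrow> bool" where
  "periodic_W32 u0 u1 u2 u3 \<longleftrightarrow> W32 u0 u1 u2 u3 \<and> u0 1 = u0 0 \<and> u1 1 = u1 0 \<and> u2 1 = u2 0"

text \<open>Unbounded operators are given by their graphs, closed under almost-everywhere equality
  in both components.\<close>

type_synonym L2_operator = "((real \<Rightarrow> complex) \<times> (real \<Rightarrow> complex)) set"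

definition L_zero :: L2_operator where
  "L_zero = {(y, f). y \<in> L2 \<and> f \<in> L2 \<and>
     (\<exists>u0 u1 u2 u3. periodic_W32 u0 u1 u2 u3 \<and> (AE x in unit_leb. y x = u0 x) \<and>
        (AE x in unit_leb. f x = \<i> * u3 x))}"

definition L_nonlocal :: "real \<Rightarrow> (real \<Rightarrow> complex) \<Rightarrow> L2_operator" where
  "L_nonlocal \<alpha> v = {(y, f). y \<in> L2 \<and> f \<in> L2 \<and>
     (\<exists>u0 u1 u2 u3. periodic_W32 u0 u1 u2 u3 \<and> (AE x in unit_leb. y x = u0 x) \<and>
        (AE x in unit_leb. f x = \<i> * u3 x + of_real \<alpha> * L2_inner y v * v x))}"

text \<open>\<open>T - z\<close> is onto and bounded below, that is, a bijection onto the whole space (modulo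
  almost-everywhere equality) with bounded inverse.\<close>

definition resolvent_set :: "L2_operator \<Rightarrow> complex set" where
  "resolvent_set T = {z.
     (\<forall>f\<in>L2. \<exists>(y, h)\<in>T. AE x in unit_leb. h x - z * y x = f x) \<and>
     (\<exists>C. \<forall>(y, h)\<in>T. L2_norm y \<le> C * L2_norm (\<lambda>x. h x - z * y x))}"

definition spectrum :: "L2_operator \<Rightarrow> complex set" where
  "spectrum T = - resolvent_set T"

definition eigenspace :: "L2_operator \<Rightarrow> complex \<Rightarrow> (real \<Rightarrow> complex) set" where
  "eigenspace T z = {y. \<exists>h. (y, h) \<in> T \<and> (AE x in unit_leb. h x = z * y x)}"

text \<open>Complex linear independence of \<open>u 0, \<dots>, u (n - 1)\<close> modulo almost-everywhere equality.\<close>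

definition L2_independent :: "nat \<Rightarrow> (nat \<Rightarrow> real \<Rightarrow> complex) \<Rightarrow> bool" where
  "L2_independent n u \<longleftrightarrow>
     (\<forall>c :: nat \<Rightarrow> complex. (AE x in unit_leb. (\<Sum>i<n. c i * u i x) = 0) \<longrightarrow> (\<forall>i<n. c i = 0))"

definition multiplicity_at :: "L2_operator \<Rightarrow> complex \<Rightarrow> enat" where
  "multiplicity_at T z =
     Sup {enat n | n. \<exists>u. (\<forall>i<n. u i \<in> eigenspace T z) \<and> L2_independent n u}"

text \<open>The spectrum with its points counted according to multiplicity, as a set of pairs
  (spectral point, dimension of its eigenspace). The multiplicities are part of the data: a
  rank-one perturbation of a simple spectrum can have double eigenvalues, and the bare point
  sets do not determine the non-local potential.\<close>

definition spectrum_mult :: "L2_operator \<Rightarrow> (complex \<times> enat) set" where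
  "spectrum_mult T = {(z, multiplicity_at T z) | z. z \<in> spectrum T}"

definition shift_fun :: "real \<Rightarrow> complex" where
  "shift_fun x = of_real (1 - x)"

end

theory Submission
  imports Defs "HOL-Complex_Analysis.Complex_Analysis"
begin

text \<open>In the orthonormal basis \<open>exp (2 \<pi> i n x)\<close> the operator \<open>L_0\<close> is diagonal with the simple
  eigenvalues \<open>lam n = (2 \<pi> n)\<^sup>3\<close>, and \<open>L_\<alpha>(v)\<close> is a rank-one perturbation of it. Off the points
  \<open>lam n\<close> its eigenvalues are the zeros of \<open>F(z) = 1 + \<Sum>\<^sub>n \<alpha> |v\<^sub>n|\<^sup>2 / (lam n - z)\<close>, and the
  multiplicity at \<open>lam n\<close> tells whether \<open>F\<close> has a pole, a regular point or a zero there. Hence two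
  potentials with the same spectra have functions \<open>F\<close>, \<open>G\<close> whose quotient is entire and zero free,
  so \<open>F / G = exp h\<close>. Off the real axis neither function takes values in the nonpositive reals, so
  \<open>Im h\<close> is bounded, \<open>h\<close> is constant by Liouville's theorem, and \<open>F = G\<close> since both tend to 1 along
  the imaginary axis. Thus the spectrum determines all \<open>\<alpha> |v\<^sub>n|\<^sup>2\<close>. By Parseval and \<open>\<parallel>v\<parallel> = 1\<close> these sum
  to \<open>\<alpha>\<close>, and if \<open>\<alpha> \<noteq> 0\<close> the numbers \<open>|v\<^sub>n|\<close>, \<open>|v\<^sub>n + g\<^sub>n|\<close>, \<open>|v\<^sub>n + i g\<^sub>n|\<close> determine \<open>v\<^sub>n\<close>
  because all Fourier coefficients of \<open>g\<close> are nonzero.\<close>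

section \<open>Functions with poles at the free eigenvalues\<close>

text \<open>Functions with equal zeros and poles agree only up to a factor \<open>exp h\<close>.
  What controls \<open>h\<close> without growth estimates is the constant sign of the weights
  \<open>\<alpha> * |v_n|^2\<close>: off the real axis all terms of \<open>F\<close> have imaginary
  parts of one sign, so \<open>F\<close> is either constantly 1 or takes only nonreal values there.
  The same sign forces the zeros of \<open>F\<close> to be real and simple, and its poles are simple
  by construction. Equality of divisors thus reduces to equality of two sets, and eigenspace
  dimensions reveal both: at \<open>lam n\<close> a nonzero eigenspace means that there is no pole,
  and two independent eigenfunctions mean a zero of \<open>F\<close>; elsewhere a nonzero eigenspace
  means a zero of \<open>F\<close>. The resolvent set is never computed; it enters only through the
  triviality of eigenspaces over it. The cubic growth of \<open>lam n\<close> lets all estimates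
  work with merely bounded coefficients, so difference quotients of \<open>F\<close> stay within the
  same class of functions.\<close>

lemma summable_on_int:
  fixes g :: "int \<Rightarrow> real"
  assumes nonneg: "\<And>n. g n \<ge> 0"
    and pos: "summable (\<lambda>n. g (int n))" and neg: "summable (\<lambda>n. g (- int n))"
  shows "g summable_on UNIV"
proof -
  have "g summable_on range int"
    using pos nonneg by (subst summable_on_reindex) (auto simp: o_def summable_on_UNIV_nonneg_real_iff)
  moreover have "g summable_on range (\<lambda>n. - int n)"
    using neg nonneg by (subst summable_on_reindex)
      (auto simp: o_def summable_on_UNIV_nonneg_real_iff inj_on_def)
  ultimately have "g summable_on (range int \<union> range (\<lambda>n. - int n))"
    by (rule summable_on_union)
  moreover have "range int \<union> range (\<lambda>n. - int n) = UNIV"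
    by (auto simp: image_iff) (metis int_cases2)
  ultimately show ?thesis by simp
qed

lemma infsum_diff:
  fixes f g :: "'a \<Rightarrow> 'b :: {topological_ab_group_add, t2_space}"
  assumes "f summable_on A" "g summable_on A"
  shows "infsum (\<lambda>x. f x - g x) A = infsum f A - infsum g A"
  using infsum_add[OF assms(1), of "\<lambda>x. - g x"] assms(2) by (simp add: infsum_uminus summable_on_uminus)

lemma summable_on_int_powr:
  fixes p :: real
  assumes "p < -1"
  shows "(\<lambda>n::int. \<bar>real_of_int n\<bar> powr p) summable_on UNIV"
  using assms by (intro summable_on_int) (auto simp: summable_real_powr_iff)

lemma summable_on_int_inverse_square: "(\<lambda>n::int. 1 / (real_of_int n)\<^sup>2) summable_on UNIV"
proof -
  have "(\<lambda>n::int. \<bar>real_of_int n\<bar> powr (-2)) = (\<lambda>n. 1 / (real_of_int n)\<^sup>2)"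
    by (auto simp: powr_minus field_simps fun_eq_iff)
  then show ?thesis
    using summable_on_int_powr[of "-2"] by simp
qed

definition lam :: "int \<Rightarrow> real" where
  "lam n = (2 * pi * real_of_int n) ^ 3"

lemma lam_eq_iff [simp]: "lam m = lam n \<longleftrightarrow> m = n"
proof
  assume "lam m = lam n"
  then have "root 3 (lam m) = root 3 (lam n)" by simp
  then show "m = n" by (simp add: lam_def odd_real_root_power_cancel)
qed simp

lemma lam_0 [simp]: "lam 0 = 0"
  by (simp add: lam_def)

text \<open>A crude consequence of \<open>(2 * pi)^3 >= 2\<close>. The factor 2 leaves room: once
  \<open>|z| <= |n|^3\<close>, the distance from \<open>lam n\<close> to \<open>z\<close> is still
  at least \<open>|n|^3\<close>.\<close>

lemma lam_ge: "2 * \<bar>real_of_int n\<bar> ^ 3 \<le> \<bar>lam n\<bar>"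
proof -
  have "2 \<le> 2 * pi" using pi_ge_two by linarith
  then have "2 ^ 3 \<le> (2 * pi) ^ 3" by (intro power_mono) auto
  then have "2 \<le> (2 * pi) ^ 3" by simp
  then have "2 * \<bar>real_of_int n\<bar> ^ 3 \<le> (2 * pi) ^ 3 * \<bar>real_of_int n\<bar> ^ 3"
    by (intro mult_right_mono) auto
  then show ?thesis
    by (simp add: lam_def power_mult_distrib abs_mult power_abs)
qed

lemma int_square_le_cube: "(real_of_int n)\<^sup>2 \<le> \<bar>real_of_int n\<bar> ^ 3"
proof (cases "n = 0")
  case False
  then have "1 \<le> \<bar>real_of_int n\<bar>" by linarith
  then have "\<bar>real_of_int n\<bar> ^ 2 \<le> \<bar>real_of_int n\<bar> ^ 3" by (intro power_increasing) auto
  then show ?thesis by simp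
qed simp

text \<open>Since \<open>x / 0 = 0\<close>, the value at \<open>z = lam k\<close> omits the \<open>k\<close>-th term; it is the value of the
  analytic function there exactly when \<open>a k = 0\<close>.\<close>

definition pole_sum :: "(int \<Rightarrow> complex) \<Rightarrow> complex \<Rightarrow> complex" where
  "pole_sum a z = (\<Sum>\<^sub>\<infinity>n. a n / (of_real (lam n) - z))"

lemma pole_term_bound:
  assumes a: "\<And>n. cmod (a n) \<le> M" and z: "cmod z \<le> R" and n: "R \<le> \<bar>real_of_int n\<bar>" "n \<noteq> 0"
  shows "cmod (a n / (of_real (lam n) - z)) \<le> M * (1 / (real_of_int n)\<^sup>2)"
proof -
  have n1: "1 \<le> \<bar>real_of_int n\<bar>" using n by linarith
  have M: "M \<ge> 0" using a[of 0] norm_ge_zero order_trans by blast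
  have "\<bar>real_of_int n\<bar> ^ 1 \<le> \<bar>real_of_int n\<bar> ^ 3" using n1 by (intro power_increasing) auto
  then have "cmod z \<le> \<bar>real_of_int n\<bar> ^ 3" using z n by simp
  moreover have "\<bar>lam n\<bar> - cmod z \<le> cmod (of_real (lam n) - z)"
    by (metis norm_of_real norm_triangle_ineq2)
  ultimately have "(real_of_int n)\<^sup>2 \<le> cmod (of_real (lam n) - z)"
    using lam_ge[of n] int_square_le_cube[of n] by linarith
  moreover have "0 < (real_of_int n)\<^sup>2" using n by simp
  ultimately have "cmod (a n) / cmod (of_real (lam n) - z) \<le> M / (real_of_int n)\<^sup>2"
    using a M by (intro frac_le) auto
  then show ?thesis by (simp add: norm_divide)
qed

lemma finite_int_less: "finite {n::int. \<bar>real_of_int n\<bar> < R}"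
proof (rule finite_subset)
  show "{n::int. \<bar>real_of_int n\<bar> < R} \<subseteq> {- \<lceil>R\<rceil>..\<lceil>R\<rceil>}"
    by (auto; linarith)
qed auto

text \<open>The cubic growth of \<open>lam n\<close> leaves only finitely many poles in a disc and
  dominates the other terms by inverse squares. This is the input of the Weierstrass M-test.\<close>

lemma pole_terms_bound_uniform:
  assumes a: "\<And>n. cmod (a n) \<le> M"
  shows "\<exists>(A :: int set) (h :: int \<Rightarrow> real). finite A \<and> h summable_on (- A) \<and>
    (\<forall>n z. n \<in> - A \<longrightarrow> cmod z \<le> R \<longrightarrow>
       of_real (lam n) \<noteq> z \<and> cmod (a n / (of_real (lam n) - z)) \<le> h n)"
proof (intro exI conjI allI impI)
  \<comment> \<open>The 1 puts \<open>n = 0\<close> into the exceptional set, since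
    \<open>lam 0 = 0\<close> admits no useful lower bound.\<close>
  define A where "A = {n::int. \<bar>real_of_int n\<bar> < max 1 R}"
  show "finite A" unfolding A_def by (rule finite_int_less)
  show "(\<lambda>n. M * (1 / (real_of_int n)\<^sup>2)) summable_on (- A)"
    by (intro summable_on_cmult_right summable_on_subset_banach[OF summable_on_int_inverse_square]) auto
  fix n z assume n: "n \<in> - A" and z: "cmod z \<le> R"
  have n1: "R \<le> \<bar>real_of_int n\<bar>" "1 \<le> \<bar>real_of_int n\<bar>" using n by (auto simp: A_def)
  then show "cmod (a n / (of_real (lam n) - z)) \<le> M * (1 / (real_of_int n)\<^sup>2)"
    using z by (intro pole_term_bound[OF a, of z R]) auto
  have "\<bar>real_of_int n\<bar> ^ 1 \<le> \<bar>real_of_int n\<bar> ^ 3" using n1 by (intro power_increasing) auto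
  then have "R < \<bar>lam n\<bar>" using n1 lam_ge[of n] by (smt (verit) power_one_right)
  then show "of_real (lam n) \<noteq> z" using z by auto
qed

lemma pole_sum_abs_summable:
  assumes a: "\<And>n. cmod (a n) \<le> M"
  shows "(\<lambda>n. norm (a n / (of_real (lam n) - z))) summable_on UNIV"
proof -
  obtain A :: "int set" and h where fin: "finite A" and h: "h summable_on (- A)"
    and bd: "\<And>n w. n \<in> - A \<Longrightarrow> cmod w \<le> cmod z \<Longrightarrow> cmod (a n / (of_real (lam n) - w)) \<le> h n"
    using pole_terms_bound_uniform[of a M "cmod z", OF a] by auto
  have "(\<lambda>n. norm (a n / (of_real (lam n) - z))) summable_on (- A)"
    using bd by (intro Infinite_Sum.abs_summable_on_comparison_test'[OF h]) auto
  moreover have "(\<lambda>n. norm (a n / (of_real (lam n) - z))) summable_on A"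
    using fin by (intro summable_on_finite)
  ultimately have "(\<lambda>n. norm (a n / (of_real (lam n) - z))) summable_on (- A \<union> A)"
    by (rule summable_on_union)
  then show ?thesis by (simp add: Un_commute)
qed

lemma pole_sum_summable:
  assumes "\<And>n. cmod (a n) \<le> M"
  shows "(\<lambda>n. a n / (of_real (lam n) - z)) summable_on UNIV"
  using pole_sum_abs_summable[OF assms] by (rule abs_summable_summable)

lemma pole_sum_analytic:
  assumes a: "\<And>n. cmod (a n) \<le> M" and p: "\<And>n. of_real (lam n) = p \<Longrightarrow> a n = 0"
  shows "pole_sum a analytic_on {p}"
proof -
  define R where "R = cmod p + 1"
  obtain A h where fin: "finite A" and h: "h summable_on (- A)"
    and nz: "\<And>n z. n \<in> - A \<Longrightarrow> cmod z \<le> R \<Longrightarrow> of_real (lam n) \<noteq> z"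
    and bd: "\<And>n z. n \<in> - A \<Longrightarrow> cmod z \<le> R \<Longrightarrow> cmod (a n / (of_real (lam n) - z)) \<le> h n"
    using pole_terms_bound_uniform[of a M R, OF a] by auto
  define T where "T = (\<lambda>z. \<Sum>\<^sub>\<infinity>n\<in>-A. a n / (of_real (lam n) - z))"
  have ul: "uniform_limit (cball 0 R) (\<lambda>X z. \<Sum>n\<in>X. a n / (of_real (lam n) - z)) T (finite_subsets_at_top (-A))"
    unfolding T_def using bd h by (intro Weierstrass_m_test_general) auto
  have ev: "\<forall>\<^sub>F X in finite_subsets_at_top (-A). 
     continuous_on (cball 0 R) (\<lambda>z. \<Sum>n\<in>X. a n / (of_real (lam n) - z)) \<and>
     (\<lambda>z. \<Sum>n\<in>X. a n / (of_real (lam n) - z)) holomorphic_on ball 0 R"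
  proof (rule eventually_finite_subsets_at_top_weakI)
    fix X assume X: "finite X" "X \<subseteq> - A"
    have *: "complex_of_real (lam n) - z \<noteq> 0" if "n \<in> X" "cmod z \<le> R" for n z
      using nz[of n z] that X by auto
    show "continuous_on (cball 0 R) (\<lambda>z. \<Sum>n\<in>X. a n / (of_real (lam n) - z)) \<and>
     (\<lambda>z. \<Sum>n\<in>X. a n / (of_real (lam n) - z)) holomorphic_on ball 0 R"
      using * by (auto intro!: continuous_intros holomorphic_intros)
  qed
  have T: "T holomorphic_on ball 0 R"
    using holomorphic_uniform_limit[OF ev ul] by auto

  then have Tp: "T analytic_on {p}"
    by (rule holomorphic_on_imp_analytic_at) (auto simp: R_def)
  have "(\<lambda>z. a n / (of_real (lam n) - z)) analytic_on {p}" for n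
    using p[of n] by (cases "of_real (lam n) = p") (auto intro!: analytic_intros)
  then have "(\<lambda>z. (\<Sum>n\<in>A. a n / (of_real (lam n) - z)) + T z) analytic_on {p}"
    using Tp by (intro analytic_on_add analytic_on_sum)
  moreover have "pole_sum a = (\<lambda>z. (\<Sum>n\<in>A. a n / (of_real (lam n) - z)) + T z)"
  proof
    fix z
    have "(\<lambda>n. a n / (of_real (lam n) - z)) summable_on UNIV"
      by (rule pole_sum_summable[OF a])
    then have *: "(\<lambda>n. a n / (of_real (lam n) - z)) summable_on (-A)"
      by (rule summable_on_subset_banach) auto
    have "pole_sum a z = (\<Sum>\<^sub>\<infinity>n\<in>A \<union> -A. a n / (of_real (lam n) - z))"
      by (simp add: pole_sum_def)
    also have "\<dots> = (\<Sum>n\<in>A. a n / (of_real (lam n) - z)) + T z"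
      using * fin by (subst infsum_Un_disjoint) (auto simp: T_def)
    finally show "pole_sum a z = (\<Sum>n\<in>A. a n / (of_real (lam n) - z)) + T z" .
  qed
  ultimately show ?thesis by simp
qed

lemma pole_sum_split:
  assumes a: "\<And>n. cmod (a n) \<le> M"
  shows "pole_sum a z = a k / (of_real (lam k) - z) + pole_sum (a(k := 0)) z"
proof -
  have *: "(\<lambda>n. a n / (of_real (lam n) - z)) summable_on (-{k})"
    by (rule summable_on_subset_banach[OF pole_sum_summable[OF a]]) auto
  have "pole_sum a z = (\<Sum>\<^sub>\<infinity>n\<in>{k} \<union> -{k}. a n / (of_real (lam n) - z))"
    by (simp add: pole_sum_def)
  also have "\<dots> = a k / (of_real (lam k) - z) + (\<Sum>\<^sub>\<infinity>n\<in>-{k}. a n / (of_real (lam n) - z))"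
    using * by (subst infsum_Un_disjoint) auto
  also have "(\<Sum>\<^sub>\<infinity>n\<in>-{k}. a n / (of_real (lam n) - z)) = pole_sum (a(k := 0)) z"
    unfolding pole_sum_def by (rule infsum_cong_neutral) auto
  finally show ?thesis .
qed

text \<open>The terms at a fixed point form a bounded coefficient sequence again, so the results on
  \<open>pole_sum\<close> apply to difference quotients too.\<close>

lemma pole_terms_bounded:
  assumes a: "\<And>n. cmod (a n) \<le> M"
  shows "cmod (a n / (of_real (lam n) - z)) \<le> (\<Sum>\<^sub>\<infinity>n. cmod (a n / (of_real (lam n) - z)))"
  using finite_sum_le_infsum[OF pole_sum_abs_summable[OF a, where z = z], where B = "{n}"] by simp

text \<open>Termwise this is the resolvent identity
  \<open>1/(l - z) - 1/(l - p) = (z - p)/((l - z)(l - p))\<close>.\<close>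

lemma pole_sum_diff_quotient:
  assumes a: "\<And>n. cmod (a n) \<le> M"
    and z: "\<And>n. a n \<noteq> 0 \<Longrightarrow> of_real (lam n) \<noteq> z" and p: "\<And>n. a n \<noteq> 0 \<Longrightarrow> of_real (lam n) \<noteq> p"
  shows "pole_sum a z - pole_sum a p = (z - p) * pole_sum (\<lambda>n. a n / (of_real (lam n) - p)) z"
proof -
  have "pole_sum a z - pole_sum a p
      = (\<Sum>\<^sub>\<infinity>n. a n / (of_real (lam n) - z) - a n / (of_real (lam n) - p))"
    unfolding pole_sum_def
    by (intro infsum_diff[symmetric] pole_sum_summable[OF a])
  also have "\<dots> = (\<Sum>\<^sub>\<infinity>n. (z - p) * (a n / (of_real (lam n) - p) / (of_real (lam n) - z)))"
  proof (rule infsum_cong)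
    fix n show "a n / (of_real (lam n) - z) - a n / (of_real (lam n) - p)
       = (z - p) * (a n / (of_real (lam n) - p) / (of_real (lam n) - z))"
      using z[of n] p[of n] by (cases "a n = 0") (auto simp: divide_simps algebra_simps)
  qed
  also have "\<dots> = (z - p) * pole_sum (\<lambda>n. a n / (of_real (lam n) - p)) z"
    unfolding pole_sum_def by (rule infsum_cmult_right')
  finally show ?thesis .
qed

lemma eventually_at_not_lam:
  fixes p :: complex
  shows "\<forall>\<^sub>F w in at p. \<forall>n. of_real (lam n) \<noteq> w"
proof -
  define R where "R = cmod p + 1"
  obtain A :: "int set" and h :: "int \<Rightarrow> real" where fin: "finite A" and "h summable_on (- A)"
    and nz: "\<And>n z. n \<in> - A \<Longrightarrow> cmod z \<le> R \<Longrightarrow> of_real (lam n) \<noteq> z"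
    \<comment> \<open>Only the separation of \<open>z\<close> from the distant \<open>lam n\<close>
      is wanted here, so zero coefficients will do.\<close>
    using pole_terms_bound_uniform[of "\<lambda>_. 0" 0 R] by auto
  have "finite ((\<lambda>n. complex_of_real (lam n)) ` A)" using fin by simp
  then have "\<not> p islimpt ((\<lambda>n. complex_of_real (lam n)) ` A)"
    by (rule islimpt_finite)
  then have 1: "\<forall>\<^sub>F w in at p. w \<notin> (\<lambda>n. complex_of_real (lam n)) ` A"
    by (simp add: islimpt_iff_eventually)
  have "\<forall>\<^sub>F w in at p. w \<in> ball 0 R - {p}"
    by (rule eventually_at_in_open) (auto simp: R_def)
  with 1 show ?thesis
    by eventually_elim (use nz in force)
qed

lemma infsum_constant_sign_nonzero:
  fixes f :: "'a \<Rightarrow> real"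
  assumes sgn: "(\<forall>n. f n \<ge> 0) \<or> (\<forall>n. f n \<le> 0)" and sm: "f summable_on UNIV" and k: "f k \<noteq> 0"
  shows "infsum f UNIV \<noteq> 0"
  using sgn
proof
  assume "\<forall>n. f n \<ge> 0"
  then have "f k > 0" and "f k \<le> infsum f UNIV"
    using k finite_sum_le_infsum[OF sm, of "{k}"] by (auto simp: less_le)
  then show ?thesis by simp
next
  assume "\<forall>n. f n \<le> 0"
  then have "- f k > 0" and "- f k \<le> infsum (\<lambda>n. - f n) UNIV"
    using k finite_sum_le_infsum[of "\<lambda>n. - f n" UNIV "{k}"] sm
    by (auto simp: less_le summable_on_uminus)
  then show ?thesis by (simp add: infsum_uminus)
qed

section \<open>The characteristic function (perturbation determinant): values, poles and
  zeros\<close>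

definition char_fun :: "(int \<Rightarrow> real) \<Rightarrow> complex \<Rightarrow> complex" where
  "char_fun b z = 1 + pole_sum (\<lambda>n. of_real (b n)) z"

text \<open>Satisfied by \<open>b n = \<alpha> * |v_n|^2\<close> for either sign of \<alpha>.
  Boundedness makes the sum converge; the constant sign excludes cancellation.\<close>

definition bounded_signed :: "(int \<Rightarrow> real) \<Rightarrow> bool" where
  "bounded_signed b \<longleftrightarrow> (\<exists>M. \<forall>n. \<bar>b n\<bar> \<le> M) \<and> ((\<forall>n. 0 \<le> b n) \<or> (\<forall>n. b n \<le> 0))"

lemma bounded_signedE:
  assumes "bounded_signed b"
  obtains M where "\<And>n. cmod (of_real (b n)) \<le> M"
  using assms by (auto simp: bounded_signed_def)

text \<open>The \<open>n\<close>-th term has imaginary part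
  \<open>b n * Im z / |lam n - z|^2\<close>. All these have one sign, so a single nonzero term keeps
  the sum away from 0.\<close>

lemma Im_char_fun_nonzero:
  assumes b: "bounded_signed b" and k: "b k \<noteq> 0" and z: "Im z \<noteq> 0"
  shows "Im (char_fun b z) \<noteq> 0"
proof -
  obtain M where M: "\<And>n. cmod (of_real (b n)) \<le> M" using bounded_signedE[OF b] by blast
  define f where "f n = Im (of_real (b n) / (of_real (lam n) - z))" for n
  have f: "f n = b n * (Im z / ((lam n - Re z)\<^sup>2 + (Im z)\<^sup>2))" for n
    by (simp add: f_def Im_divide power2_eq_square)
  have pos: "(lam n - Re z)\<^sup>2 + (Im z)\<^sup>2 > 0" for n
    using z by (simp add: add_nonneg_pos)
  have "Im (char_fun b z) = infsum f UNIV"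
    unfolding char_fun_def pole_sum_def f_def using infsum_Im[OF pole_sum_summable[OF M]] by simp
  moreover have "f summable_on UNIV"
    unfolding f_def by (rule summable_on_Im[OF pole_sum_summable[OF M]])
  moreover have "(\<forall>n. f n \<ge> 0) \<or> (\<forall>n. f n \<le> 0)"
  proof -
    have "(\<forall>n. 0 \<le> b n) \<or> (\<forall>n. b n \<le> 0)" using b by (simp add: bounded_signed_def)
    then show ?thesis
    proof (cases "Im z > 0")
      case True
      then have "0 \<le> Im z / ((lam n - Re z)\<^sup>2 + (Im z)\<^sup>2)" for n
        using pos[of n] by simp
      then show ?thesis
        using \<open>(\<forall>n. 0 \<le> b n) \<or> _\<close> unfolding f by (meson mult_nonneg_nonneg mult_nonpos_nonneg)
    next
      case False
      then have "Im z / ((lam n - Re z)\<^sup>2 + (Im z)\<^sup>2) \<le> 0" for n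
        using pos[of n] by (intro divide_nonpos_pos) auto
      then show ?thesis
        using \<open>(\<forall>n. 0 \<le> b n) \<or> _\<close> unfolding f by (meson mult_nonneg_nonpos mult_nonpos_nonpos)
    qed
  qed
  moreover have "f k \<noteq> 0" using k z pos[of k] by (simp add: f)
  ultimately show ?thesis using infsum_constant_sign_nonzero by metis
qed

text \<open>This makes the principal logarithm of \<open>char_fun b\<close> holomorphic on each open
  half plane. With all weights 0 the function is 1, which needs a case of its own.\<close>

lemma char_fun_not_nonpos_Real:
  assumes b: "bounded_signed b" and z: "Im z \<noteq> 0"
  shows "char_fun b z \<notin> \<real>\<^sub>\<le>\<^sub>0"
proof (cases "\<exists>k. b k \<noteq> 0")
  case True
  then show ?thesis using Im_char_fun_nonzero[OF b _ z] by (auto elim!: nonpos_Reals_cases)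
next
  case False
  then have "char_fun b z = 1" by (simp add: char_fun_def pole_sum_def)
  then show ?thesis by simp
qed

lemma char_fun_analytic:
  assumes b: "bounded_signed b" and p: "\<And>n. of_real (lam n) = p \<Longrightarrow> b n = 0"
  shows "char_fun b analytic_on {p}"
proof -
  obtain M where M: "\<And>n. cmod (of_real (b n)) \<le> M" using bounded_signedE[OF b] by blast
  have "pole_sum (\<lambda>n. of_real (b n)) analytic_on {p}"
    by (rule pole_sum_analytic[OF M]) (use p in auto)
  then show ?thesis unfolding char_fun_def by (intro analytic_intros)
qed

lemma char_fun_at_pole:
  assumes b: "bounded_signed b"
  obtains g where "g analytic_on {of_real (lam k)}" "g (of_real (lam k)) = - of_real (b k)"
    "\<And>w. w \<noteq> of_real (lam k) \<Longrightarrow> char_fun b w = g w * (w - of_real (lam k)) powi (-1)"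
proof
  obtain M where M: "\<And>n. cmod (of_real (b n)) \<le> M" using bounded_signedE[OF b] by blast
  have M': "cmod (((\<lambda>n. of_real (b n))(k := 0)) n) \<le> M" for n
    using M[of n] norm_ge_zero[of "of_real (b n) :: complex"] by (cases "n = k") auto
  define r where "r = pole_sum ((\<lambda>n. of_real (b n))(k := 0))"
  have r: "r analytic_on {of_real (lam k)}"
    unfolding r_def by (rule pole_sum_analytic[OF M']) auto
  define g where "g w = - of_real (b k) + (w - of_real (lam k)) * (1 + r w)" for w
  show "g analytic_on {of_real (lam k)}"
    unfolding g_def using r by (intro analytic_intros)
  show "g (of_real (lam k)) = - of_real (b k)" by (simp add: g_def)
  fix w assume w: "w \<noteq> complex_of_real (lam k)"
  have "char_fun b w = 1 + (of_real (b k) / (of_real (lam k) - w) + r w)"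
    unfolding char_fun_def r_def using pole_sum_split[OF M, where z = w and k = k] by simp
  also have "of_real (b k) / (of_real (lam k) - w) = - of_real (b k) / (w - of_real (lam k))"
    by (metis minus_diff_eq minus_divide_left minus_divide_right)
  also have "1 + (- of_real (b k) / (w - of_real (lam k)) + r w) = g w / (w - of_real (lam k))"
    using w by (simp add: g_def add_divide_distrib diff_divide_distrib)
  also have "\<dots> = g w * (w - of_real (lam k)) powi (-1)"
    by (simp add: power_int_minus divide_inverse)
  finally show "char_fun b w = g w * (w - of_real (lam k)) powi (-1)" .
qed

text \<open>Zeros are simple: they lie on the real axis, and there the derivative is the sum of
  \<open>b n / (lam n - x)^2\<close>, whose terms have one sign and do not all vanish.\<close>

lemma char_fun_at_zero:
  assumes b: "bounded_signed b" and p: "\<And>n. of_real (lam n) = p \<Longrightarrow> b n = 0"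
    and zero: "char_fun b p = 0"
  obtains g where "g analytic_on {p}" "g p \<noteq> 0" "\<forall>\<^sub>F w in at p. char_fun b w = g w * (w - p)"
proof
  obtain M where M: "\<And>n. cmod (of_real (b n)) \<le> M" using bounded_signedE[OF b] by blast
  obtain k where k: "b k \<noteq> 0"
    using zero by (cases "\<forall>k. b k = 0") (auto simp: char_fun_def pole_sum_def)
  have Im: "Im p = 0"
    using Im_char_fun_nonzero[OF b k, of p] zero by auto
  define x where "x = Re p"
  have px: "p = of_real x" using Im by (simp add: x_def complex_eq_iff)
  \<comment> \<open>With these coefficients \<open>pole_sum a\<close> is the difference quotient of
    \<open>char_fun b\<close> at \<open>p\<close>; its value at \<open>p\<close> is the
    derivative.\<close>
  define a where "a n = complex_of_real (b n) / (of_real (lam n) - p)" for n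
  define M' where "M' = (\<Sum>\<^sub>\<infinity>n. cmod (a n))"
  have M': "cmod (a n) \<le> M'" for n
    unfolding M'_def a_def by (rule pole_terms_bounded[OF M])
  show "pole_sum a analytic_on {p}"
    by (rule pole_sum_analytic[OF M']) (auto simp: a_def)
  define f where "f n = Re (a n / (of_real (lam n) - p))" for n
  have f: "f n = b n / (lam n - x)\<^sup>2" for n
  proof -
    have "a n / (of_real (lam n) - p) = of_real (b n / (lam n - x)\<^sup>2)"
      by (simp add: a_def px power2_eq_square)
    then show ?thesis by (simp add: f_def)
  qed
  have "infsum f UNIV \<noteq> 0"
  proof (rule infsum_constant_sign_nonzero[where k = k])
    have "(\<forall>n. 0 \<le> b n) \<or> (\<forall>n. b n \<le> 0)" using b by (simp add: bounded_signed_def)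
    then show "(\<forall>n. f n \<ge> 0) \<or> (\<forall>n. f n \<le> 0)"
      by (auto simp: f divide_nonneg_nonneg divide_nonpos_nonneg)
    show "f summable_on UNIV"
      unfolding f_def by (rule summable_on_Re[OF pole_sum_summable[OF M']])
    show "f k \<noteq> 0" using k p[of k] by (auto simp: f px)
  qed
  moreover have "infsum f UNIV = Re (pole_sum a p)"
    unfolding f_def pole_sum_def by (rule infsum_Re[OF pole_sum_summable[OF M']])
  ultimately show "pole_sum a p \<noteq> 0" by auto
  show "\<forall>\<^sub>F w in at p. char_fun b w = pole_sum a w * (w - p)"
    using eventually_at_not_lam[of p]
  proof eventually_elim
    case (elim w)
    have "char_fun b w - char_fun b p = (w - p) * pole_sum a w"
      unfolding char_fun_def a_def
      using pole_sum_diff_quotient[of "\<lambda>n. of_real (b n)" M w p, OF M] elim p by auto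
    then show ?case using zero by simp
  qed
qed


section \<open>The Liouville argument for quotients of characteristic functions\<close>

lemma Ln_ratio_bounded_Im:
  assumes U: "convex U" "open U" and f: "f holomorphic_on U" and g: "g holomorphic_on U" and h: "h holomorphic_on U"
    and f0: "\<And>z. z \<in> U \<Longrightarrow> f z \<notin> \<real>\<^sub>\<le>\<^sub>0" and g0: "\<And>z. z \<in> U \<Longrightarrow> g z \<notin> \<real>\<^sub>\<le>\<^sub>0"
    and eq: "\<And>z. z \<in> U \<Longrightarrow> exp (h z) = f z / g z"
  shows "\<exists>B. \<forall>z\<in>U. \<bar>Im (h z)\<bar> \<le> B"
proof -
  \<comment> \<open>\<open>k\<close> is the discrepancy between \<open>h\<close> and the difference
    of principal logarithms. Since \<open>exp k = 1\<close>, its derivative vanishes and it is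
    constant on the convex set \<open>U\<close>; each logarithm then adds at most \<open>pi\<close>
    to the imaginary part.\<close>
  define k where "k z = h z - Ln (f z) + Ln (g z)" for z
  have k_hol: "k holomorphic_on U"
    unfolding k_def using f g h f0 g0 by (intro holomorphic_intros) auto
  have nz: "f z \<noteq> 0" "g z \<noteq> 0" if "z \<in> U" for z
    using f0[OF that] g0[OF that] by auto
  have exp_k: "exp (k z) = 1" if "z \<in> U" for z
    using that nz eq by (simp add: k_def exp_add exp_diff)
  have "(k has_field_derivative 0) (at z within U)" if z: "z \<in> U" for z
  proof -
    have d: "(k has_field_derivative deriv k z) (at z)"
      using holomorphic_derivI[OF k_hol \<open>open U\<close> z] .
    then have "((\<lambda>z. exp (k z)) has_field_derivative exp (k z) * deriv k z) (at z)"
      by (rule DERIV_fun_exp)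
    moreover have "((\<lambda>z. exp (k z)) has_field_derivative 0) (at z)"
      by (rule has_field_derivative_transform_within_open[of "\<lambda>_. 1", OF _ \<open>open U\<close> z])
        (use exp_k in auto)
    ultimately have "exp (k z) * deriv k z = 0" by (rule DERIV_unique)
    then show ?thesis using d by (simp add: has_field_derivative_at_within)
  qed
  then obtain c where c: "\<And>z. z \<in> U \<Longrightarrow> k z = c"
    using has_field_derivative_zero_constant[OF \<open>convex U\<close>] by blast
  have "\<bar>Im (h z)\<bar> \<le> \<bar>Im c\<bar> + 2 * pi" if z: "z \<in> U" for z
  proof -
    have "h z = c + Ln (f z) - Ln (g z)" using c[OF z] by (simp add: k_def algebra_simps)
    moreover have "\<bar>Im (Ln (f z))\<bar> \<le> pi" "\<bar>Im (Ln (g z))\<bar> \<le> pi"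
      using mpi_less_Im_Ln Im_Ln_le_pi nz[OF z] by (auto simp: abs_le_iff less_imp_le) (smt (verit) mpi_less_Im_Ln)+
    ultimately show ?thesis by simp
  qed
  then show ?thesis by blast
qed

text \<open>The modulus of \<open>exp (i h)\<close> is \<open>exp (- Im h)\<close>, so Liouville
  applies to this function. As \<open>exp\<close> has no zeros, differentiating the constant gives
  \<open>h' = 0\<close>.\<close>

lemma entire_Im_bounded_constant:
  assumes h: "h holomorphic_on UNIV" and B: "\<And>z. \<bar>Im (h z)\<bar> \<le> B"
  shows "\<exists>c. \<forall>z. h z = c"
proof -
  have "(\<lambda>z. exp (\<i> * h z)) constant_on UNIV"
  proof (rule Liouville_theorem)
    show "(\<lambda>z. exp (\<i> * h z)) holomorphic_on UNIV" using h by (intro holomorphic_intros)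
    have "cmod (exp (\<i> * h z)) \<le> exp B" for z
      using B[of z] by (simp add: norm_exp_eq_Re)
    then show "bounded (range (\<lambda>z. exp (\<i> * h z)))" by (auto simp: bounded_iff)
  qed
  then obtain c where c: "\<And>z. exp (\<i> * h z) = c" by (auto simp: constant_on_def)
  have "(h has_field_derivative 0) (at z within UNIV)" for z
  proof -
    have d: "(h has_field_derivative deriv h z) (at z)"
      using holomorphic_derivI[OF h] by auto
    then have "((\<lambda>z. exp (\<i> * h z)) has_field_derivative exp (\<i> * h z) * (\<i> * deriv h z)) (at z)"
      by (auto intro!: derivative_eq_intros)
    moreover have "((\<lambda>z. exp (\<i> * h z)) has_field_derivative 0) (at z)"
      unfolding c by simp
    ultimately have "exp (\<i> * h z) * (\<i> * deriv h z) = 0" by (rule DERIV_unique)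
    then show ?thesis using d by simp
  qed
  then show ?thesis
    using has_field_derivative_zero_constant[of UNIV h] by auto
qed

text \<open>The inequality \<open>(lam n)^2 + y^2 >= 2 * |lam n| * y\<close> bounds the distance
  from \<open>lam n\<close> to \<open>i y\<close> below by \<open>|n| powr (3/2) * sqrt y\<close>.
  The exponent exceeds 1, so a factor \<open>1 / sqrt y\<close> splits off from a summable majorant.
  At \<open>n = 0\<close> the distance is \<open>y\<close>, which is at least \<open>sqrt y\<close>
  for \<open>y >= 1\<close>; hence the value 1 of \<open>h\<close> there.\<close>

lemma pole_sum_imaginary_axis_tendsto:
  assumes a: "\<And>n. cmod (a n) \<le> M"
  shows "((\<lambda>y. pole_sum a (of_real y * \<i>)) \<longlongrightarrow> 0) at_top"
proof -
  define h where "h n = (if n = 0 then 1 else \<bar>real_of_int n\<bar> powr (-3/2))" for n :: int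
  have "(\<lambda>n. \<bar>real_of_int n\<bar> powr (-3/2)) summable_on (-{0})"
    by (rule summable_on_subset_banach[OF summable_on_int_powr]) auto
  then have "h summable_on (-{0})"
    by (rule summable_on_cong[THEN iffD1, rotated]) (auto simp: h_def)
  then have "h summable_on ({0} \<union> -{0})"
    by (intro summable_on_union) auto
  then have h: "h summable_on UNIV" by simp
  have M: "M \<ge> 0" using a[of 0] norm_ge_zero order_trans by blast
  have bd: "cmod (a n / (of_real (lam n) - of_real y * \<i>)) \<le> M / sqrt y * h n" if y: "y \<ge> 1" for n y
  proof -
    define d where "d = cmod (of_real (lam n) - of_real y * \<i>)"
    have d2: "d\<^sup>2 = (lam n)\<^sup>2 + y\<^sup>2"
      by (simp add: d_def cmod_def)
    have "y\<^sup>2 \<le> d\<^sup>2" by (simp add: d2)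
    then have yd: "y \<le> d" using power2_le_imp_le[of y d] by (simp add: d_def)
    have "sqrt y \<le> y" using y real_sqrt_le_iff[of y "y\<^sup>2"] by (simp add: power2_eq_square)
    have *: "sqrt y \<le> d * h n"
    proof (cases "n = 0")
      case True
      then show ?thesis using yd \<open>sqrt y \<le> y\<close> by (simp add: h_def)
    next
      case False
      then have n: "\<bar>real_of_int n\<bar> > 0" by simp
      have "2 * (\<bar>lam n\<bar> * y) \<le> d\<^sup>2"
        using sum_squares_bound[of "\<bar>lam n\<bar>" y] by (simp add: d2)
      moreover have "2 * \<bar>real_of_int n\<bar> ^ 3 * y \<le> \<bar>lam n\<bar> * y"
        using lam_ge[of n] y by (intro mult_right_mono) auto
      moreover have "0 \<le> \<bar>real_of_int n\<bar> ^ 3 * y" using y by simp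
      ultimately have "\<bar>real_of_int n\<bar> ^ 3 * y \<le> d\<^sup>2" by (simp add: mult.assoc)
      then have "sqrt (\<bar>real_of_int n\<bar> ^ 3 * y) \<le> d"
        by (intro real_le_lsqrt) (auto simp: d_def)
      then have "sqrt (\<bar>real_of_int n\<bar> ^ 3) * sqrt y \<le> d" by (simp add: real_sqrt_mult)
      moreover have "sqrt (\<bar>real_of_int n\<bar> ^ 3) = \<bar>real_of_int n\<bar> powr (3/2)"
        using n by (simp add: powr_half_sqrt[symmetric] powr_powr flip: powr_numeral)
      ultimately have "\<bar>real_of_int n\<bar> powr (3/2) * sqrt y * h n \<le> d * h n"
        by (intro mult_right_mono) (auto simp: h_def)
      moreover have "\<bar>real_of_int n\<bar> powr (3/2) * sqrt y * h n = sqrt y"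
        using n False by (simp add: h_def powr_minus)
      ultimately show ?thesis by simp
    qed
    have dpos: "d > 0" using yd y by linarith
    have "cmod (a n) * sqrt y \<le> M * (d * h n)"
      using a[of n] * M y by (intro mult_mono) auto
    then have "cmod (a n) / d \<le> M / sqrt y * h n"
      using dpos y by (simp add: field_simps)
    then show ?thesis by (simp add: norm_divide d_def)
  qed
  have "cmod (pole_sum a (of_real y * \<i>)) \<le> M * infsum h UNIV / sqrt y" if y: "y \<ge> 1" for y
  proof -
    have "cmod (pole_sum a (of_real y * \<i>)) \<le> (\<Sum>\<^sub>\<infinity>n. cmod (a n / (of_real (lam n) - of_real y * \<i>)))"
      unfolding pole_sum_def by (rule norm_infsum_bound[OF pole_sum_abs_summable[OF a]])
    also have "\<dots> \<le> (\<Sum>\<^sub>\<infinity>n. M / sqrt y * h n)"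
      by (intro infsum_mono pole_sum_abs_summable[OF a] summable_on_cmult_right h bd y)
    also have "\<dots> = M * infsum h UNIV / sqrt y"
      by (subst infsum_cmult_right') simp
    finally show ?thesis .
  qed
  then have "\<forall>\<^sub>F y in at_top. cmod (pole_sum a (of_real y * \<i>)) \<le> M * infsum h UNIV / sqrt y"
    by (intro eventually_mono[OF eventually_ge_at_top[of "1::real"]])
  moreover have "((\<lambda>y. M * infsum h UNIV / sqrt y) \<longlongrightarrow> 0) at_top"
    by (intro tendsto_divide_0[OF tendsto_const] filterlim_at_top_imp_at_infinity sqrt_at_top)
  ultimately show ?thesis by (rule Lim_null_comparison)
qed

text \<open>\<open>supp\<close> matches the poles and \<open>zeros\<close> the zeros; as all are
  simple, their orders match as well. The guard in \<open>zeros\<close> leaves out genuine poles,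
  where the value of \<open>char_fun\<close> is an artefact of \<open>x / 0 = 0\<close>.\<close>

theorem char_fun_determines:
  assumes b: "bounded_signed b" and c: "bounded_signed c"
    and supp: "\<And>n. b n = 0 \<longleftrightarrow> c n = 0"
    and zeros: "\<And>z. (\<And>n. of_real (lam n) = z \<Longrightarrow> b n = 0) \<Longrightarrow> char_fun b z = 0 \<longleftrightarrow> char_fun c z = 0"
  shows "b = c"
proof -
  define H where "H z = char_fun b z / char_fun c z" for z
  \<comment> \<open>In each case the quotient continues analytically through \<open>p\<close> with a
    nonzero value: at a common pole or a common zero the singular factors of numerator and
    denominator cancel.\<close>
  have local: "\<exists>g. g analytic_on {p} \<and> g p \<noteq> 0 \<and> (\<forall>\<^sub>F w in at p. H w = g w)" for p
  proof -
    consider (pole) k where "p = of_real (lam k)" "b k \<noteq> 0"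
      | (zero) "\<And>n. of_real (lam n) = p \<Longrightarrow> b n = 0" "char_fun b p = 0"
      | (reg) "\<And>n. of_real (lam n) = p \<Longrightarrow> b n = 0" "char_fun b p \<noteq> 0"
      by blast
    then show ?thesis
    proof cases
      case pole
      obtain g1 where g1: "g1 analytic_on {p}" "g1 p = - of_real (b k)"
        "\<And>w. w \<noteq> p \<Longrightarrow> char_fun b w = g1 w * (w - p) powi (-1)"
        using char_fun_at_pole[OF b, of k] unfolding pole(1) by metis
      obtain g2 where g2: "g2 analytic_on {p}" "g2 p = - of_real (c k)"
        "\<And>w. w \<noteq> p \<Longrightarrow> char_fun c w = g2 w * (w - p) powi (-1)"
        using char_fun_at_pole[OF c, of k] unfolding pole(1) by metis
      have nz: "g1 p \<noteq> 0" "g2 p \<noteq> 0" using pole(2) supp[of k] g1(2) g2(2) by auto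
      have "(\<lambda>w. g1 w / g2 w) analytic_on {p}"
        using g1(1) g2(1) nz by (intro analytic_on_divide) auto
      moreover have "\<forall>\<^sub>F w in at p. H w = g1 w / g2 w"
        unfolding eventually_at_filter by (auto simp: H_def g1(3) g2(3))
      ultimately show ?thesis using nz by (intro exI[of _ "\<lambda>w. g1 w / g2 w"]) auto
    next
      case zero
      have zc: "\<And>n. of_real (lam n) = p \<Longrightarrow> c n = 0" "char_fun c p = 0"
        using zero supp zeros[of p] by auto
      obtain g1 where g1: "g1 analytic_on {p}" "g1 p \<noteq> 0" "\<forall>\<^sub>F w in at p. char_fun b w = g1 w * (w - p)"
        using char_fun_at_zero[OF b zero] by metis
      obtain g2 where g2: "g2 analytic_on {p}" "g2 p \<noteq> 0" "\<forall>\<^sub>F w in at p. char_fun c w = g2 w * (w - p)"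
        using char_fun_at_zero[OF c zc] by metis
      have "(\<lambda>w. g1 w / g2 w) analytic_on {p}"
        using g1 g2 by (intro analytic_on_divide) auto
      moreover have "\<forall>\<^sub>F w in at p. w \<noteq> p" by (simp add: eventually_at_filter)
      then have "\<forall>\<^sub>F w in at p. H w = g1 w / g2 w"
        using g1(3) g2(3) by eventually_elim (simp add: H_def)
      ultimately show ?thesis using g1 g2 by (intro exI[of _ "\<lambda>w. g1 w / g2 w"]) auto
    next
      case reg
      have rc: "\<And>n. of_real (lam n) = p \<Longrightarrow> c n = 0" "char_fun c p \<noteq> 0"
        using reg supp zeros[of p] by auto
      have "H analytic_on {p}"
        unfolding H_def using char_fun_analytic[OF b reg(1)] char_fun_analytic[OF c rc(1)] rc(2)
        by (intro analytic_on_divide) auto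
      then show ?thesis using reg rc by (intro exI[of _ H]) (auto simp: H_def)
    qed
  qed
  \<comment> \<open>Filling in the removable singularities gives an entire function without zeros,
    which has an entire logarithm.\<close>
  define E where "E = remove_sings H"
  have E_at: "E analytic_on {p} \<and> E p \<noteq> 0 \<and> (\<forall>\<^sub>F w in at p. E w = H w)" for p
  proof -
    obtain g where g: "g analytic_on {p}" "g p \<noteq> 0" "\<forall>\<^sub>F w in at p. H w = g w"
      using local[of p] by blast
    have iso: "isolated_singularity_at H p"
      using g(1,3) isolated_singularity_at_cong[of H g p p] isolated_singularity_at_analytic by blast
    have "g \<midarrow>p\<rightarrow> g p" using g(1) by (simp add: analytic_at_imp_isCont isContD)
    then have lim: "H \<midarrow>p\<rightarrow> g p"
      using g(3) by (subst tendsto_cong)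
    show ?thesis
      using remove_sings_analytic_at[OF iso lim] remove_sings_eqI[OF lim] g(2)
        eventually_remove_sings_eq_at[OF iso] by (simp add: E_def)
  qed
  have E_hol: "E holomorphic_on UNIV"
    using E_at analytic_on_analytic_at analytic_imp_holomorphic by blast
  obtain h where h: "h holomorphic_on UNIV" "\<And>z. exp (h z) = E z"
    using holomorphic_logarithm_exists[of UNIV E 0] E_hol E_at by auto
  have off: "char_fun b analytic_on {z}" "char_fun c analytic_on {z}" "char_fun b z \<notin> \<real>\<^sub>\<le>\<^sub>0"
     "char_fun c z \<notin> \<real>\<^sub>\<le>\<^sub>0" "E z = char_fun b z / char_fun c z" if z: "Im z \<noteq> 0" for z
  proof -
    have nz: "of_real (lam n) \<noteq> z" for n using z by auto
    show 1: "char_fun b analytic_on {z}" "char_fun c analytic_on {z}"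
      using nz by (auto intro!: char_fun_analytic b c)
    show 2: "char_fun b z \<notin> \<real>\<^sub>\<le>\<^sub>0" "char_fun c z \<notin> \<real>\<^sub>\<le>\<^sub>0"
      using char_fun_not_nonpos_Real[OF b z] char_fun_not_nonpos_Real[OF c z] by auto
    then have "H analytic_on {z}"
      unfolding H_def using 1 by (intro analytic_on_divide) auto
    then show "E z = char_fun b z / char_fun c z"
      by (simp add: E_def H_def)
  qed
  have half: "\<exists>B. \<forall>z\<in>U. \<bar>Im (h z)\<bar> \<le> B" if U: "convex U" "open U" "\<And>z. z \<in> U \<Longrightarrow> Im z \<noteq> 0" for U
  proof (rule Ln_ratio_bounded_Im[OF U(1,2)])
    show "char_fun b holomorphic_on U" "char_fun c holomorphic_on U"
      using off(1,2) U(3) by (meson analytic_imp_holomorphic analytic_on_analytic_at)+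
    show "h holomorphic_on U" using h(1) by (rule holomorphic_on_subset) auto
  qed (use off U(3) h(2) in auto)
  obtain B1 where B1: "\<And>z. Im z > 0 \<Longrightarrow> \<bar>Im (h z)\<bar> \<le> B1"
    using half[of "{z. Im z > 0}"] by (auto simp: convex_halfspace_Im_gt open_halfspace_Im_gt)
  obtain B2 where B2: "\<And>z. Im z < 0 \<Longrightarrow> \<bar>Im (h z)\<bar> \<le> B2"
    using half[of "{z. Im z < 0}"] by (auto simp: convex_halfspace_Im_lt open_halfspace_Im_lt)
  \<comment> \<open>The two half planes give unrelated bounds; a real point inherits the upper one
    by continuity of \<open>h\<close>.\<close>
  have "\<bar>Im (h z)\<bar> \<le> max B1 B2" for z
  proof (cases "Im z = 0")
    case True
    have "isCont h z"
      using h(1) holomorphic_on_imp_continuous_on continuous_on_eq_continuous_at open_UNIV by blast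
    moreover have "(\<lambda>n. z + \<i> * of_real (inverse (real (Suc n)))) \<longlonglongrightarrow> z + \<i> * of_real 0"
      by (intro tendsto_intros LIMSEQ_inverse_real_of_nat)
    ultimately have "(\<lambda>n. h (z + \<i> * of_real (inverse (real (Suc n))))) \<longlonglongrightarrow> h z"
      using isCont_tendsto_compose[of z h] by simp
    then have "(\<lambda>n. \<bar>Im (h (z + \<i> * of_real (inverse (real (Suc n)))))\<bar>) \<longlonglongrightarrow> \<bar>Im (h z)\<bar>"
      by (intro tendsto_intros)
    moreover have "\<bar>Im (h (z + \<i> * of_real (inverse (real (Suc n)))))\<bar> \<le> B1" for n
      using True by (intro B1) (simp del: of_nat_Suc)
    ultimately have "\<bar>Im (h z)\<bar> \<le> B1" by (intro LIMSEQ_le_const2) auto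
    then show ?thesis by simp
  next
    case False
    then show ?thesis using B1[of z] B2[of z] by linarith
  qed
  then obtain d where d: "\<And>z. h z = d"
    using entire_Im_bounded_constant[OF h(1)] by blast
  have E_const: "E z = exp d" for z using h(2)[of z] d[of z] by simp
  have lim1: "((\<lambda>y. char_fun e (of_real y * \<i>)) \<longlongrightarrow> 1) at_top" if e: "bounded_signed e" for e
  proof -
    obtain M where M: "\<And>n. cmod (of_real (e n)) \<le> M" using bounded_signedE[OF e] by blast
    show ?thesis
      unfolding char_fun_def using tendsto_add[OF tendsto_const pole_sum_imaginary_axis_tendsto[OF M], of 1] by simp
  qed
  have "((\<lambda>y. char_fun b (of_real y * \<i>) / char_fun c (of_real y * \<i>)) \<longlongrightarrow> 1 / 1) at_top"
    by (intro tendsto_divide lim1 b c) auto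
  moreover have "\<forall>\<^sub>F y in at_top. char_fun b (of_real y * \<i>) / char_fun c (of_real y * \<i>) = exp d"
    using eventually_gt_at_top[of "0::real"] 
  proof eventually_elim
    case (elim y)
    then have "Im (of_real y * \<i>) \<noteq> 0" by simp
    from off(5)[OF this] show ?case using E_const by simp
  qed
  ultimately have "((\<lambda>y::real. exp d) \<longlongrightarrow> 1 / 1) at_top"
    by (rule Lim_transform_eventually)
  then have "exp d = 1" by (simp add: tendsto_const_iff)
  then have E1: "E z = 1" for z using E_const by simp
  \<comment> \<open>Multiplying by \<open>w - lam k\<close> and passing to the limit isolates the
    single weight \<open>e k\<close>.\<close>
  have res: "((\<lambda>w. char_fun e w * (w - of_real (lam k))) \<longlongrightarrow> - of_real (e k)) (at (of_real (lam k)))"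
    if e: "bounded_signed e" for e k
  proof -
    obtain g where g: "g analytic_on {of_real (lam k)}" "g (of_real (lam k)) = - of_real (e k)"
        "\<And>w. w \<noteq> of_real (lam k) \<Longrightarrow> char_fun e w = g w * (w - of_real (lam k)) powi (-1)"
      using char_fun_at_pole[OF e, of k] by metis
    have "g \<midarrow>of_real (lam k)\<rightarrow> - of_real (e k)"
      using g(1,2) by (metis analytic_at_imp_isCont isContD)
    moreover have "\<forall>\<^sub>F w in at (of_real (lam k)). char_fun e w * (w - of_real (lam k)) = g w"
      unfolding eventually_at_filter by (auto simp: g(3) power_int_minus)
    ultimately show ?thesis by (subst tendsto_cong)
  qed
  show "b = c"
  proof
    fix k
    define p where "p = complex_of_real (lam k)"
    have "\<forall>\<^sub>F w in at p. E w = H w" using E_at by blast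
    \<comment> \<open>A quotient equal to 1 has a nonzero denominator even under
      \<open>x / 0 = 0\<close>, so the denominator can be cleared.\<close>
    then have "\<forall>\<^sub>F w in at p. char_fun b w * (w - p) = char_fun c w * (w - p)"
      by eventually_elim (auto simp: E1 H_def divide_simps split: if_splits)
    then have "((\<lambda>w. char_fun c w * (w - p)) \<longlongrightarrow> - of_real (b k)) (at p)"
      by (rule Lim_transform_eventually[OF res[OF b, of k, folded p_def]])
    then have "- complex_of_real (b k) = - of_real (c k)"
      using res[OF c, of k] unfolding p_def by (intro tendsto_unique[OF at_neq_bot])
    then show "b k = c k" by simp
  qed
qed

section \<open>Fourier series in \<open>L\<^sup>2\<close>\<close>

lemma L2_iff:
  "f \<in> L2 \<longleftrightarrow> f \<in> borel_measurable unit_leb \<and> integrable unit_leb (\<lambda>x. (cmod (f x))\<^sup>2)"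
  by (simp add: L2_def)

lemma L2_measurable [measurable_dest]: "f \<in> L2 \<Longrightarrow> f \<in> borel_measurable unit_leb"
  by (simp add: L2_def)

lemma emeasure_unit_leb_space: "emeasure unit_leb (space unit_leb) = 1"
  by (simp add: emeasure_restrict_space space_restrict_space emeasure_lborel_Ioo)

lemma finite_measure_unit_leb: "finite_measure unit_leb"
  by (rule finite_measureI) (simp only: emeasure_unit_leb_space, simp)

lemma measure_unit_leb_space: "measure unit_leb (space unit_leb) = 1"
  by (simp only: measure_def emeasure_unit_leb_space enn2real_1)

lemma integrable_unit_leb_const: "integrable unit_leb (\<lambda>x. c :: 'a :: {banach, second_countable_topology})"
  using finite_measure.integrable_const[OF finite_measure_unit_leb] .

lemma integral_unit_leb_const [simp]: "(LINT x|unit_leb. c) = (c :: real)"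
  using measure_unit_leb_space by simp

lemma L2_prod_integrable:
  assumes "f \<in> L2" "g \<in> L2"
  shows "integrable unit_leb (\<lambda>x. f x * g x)"
proof (rule Bochner_Integration.integrable_bound)
  show "integrable unit_leb (\<lambda>x. (cmod (f x))\<^sup>2 + (cmod (g x))\<^sup>2)"
    using assms by (simp add: L2_iff)
  show "(\<lambda>x. f x * g x) \<in> borel_measurable unit_leb"
    using assms by (intro borel_measurable_times L2_measurable)
  show "AE x in unit_leb. norm (f x * g x) \<le> norm ((cmod (f x))\<^sup>2 + (cmod (g x))\<^sup>2)"
  proof (rule AE_I2)
    fix x
    have "2 * (cmod (f x) * cmod (g x)) \<le> (cmod (f x))\<^sup>2 + (cmod (g x))\<^sup>2"
      using sum_squares_bound[of "cmod (f x)" "cmod (g x)"] by simp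
    moreover have "0 \<le> cmod (f x) * cmod (g x)" by simp
    ultimately have "cmod (f x) * cmod (g x) \<le> (cmod (f x))\<^sup>2 + (cmod (g x))\<^sup>2" by linarith
    then show "norm (f x * g x) \<le> norm ((cmod (f x))\<^sup>2 + (cmod (g x))\<^sup>2)"
      by (simp add: norm_mult)
  qed
qed

lemma L2_cnj: "f \<in> L2 \<Longrightarrow> (\<lambda>x. cnj (f x)) \<in> L2"
  using measurable_compose[of f unit_leb borel cnj borel] borel_measurable_continuous_onI[of cnj]
  by (auto simp: L2_iff continuous_intros)

lemma L2_inner_integrable:
  assumes "f \<in> L2" "g \<in> L2"
  shows "integrable unit_leb (\<lambda>x. f x * cnj (g x))"
  using L2_prod_integrable[OF assms(1) L2_cnj[OF assms(2)]] .

lemma norm_add_squared_le: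
  fixes a b :: complex
  shows "(cmod (a + b))\<^sup>2 \<le> 2 * (cmod a)\<^sup>2 + 2 * (cmod b)\<^sup>2"
proof -
  have "(cmod (a + b))\<^sup>2 \<le> (cmod a + cmod b)\<^sup>2"
    by (intro power_mono norm_triangle_ineq) auto
  also have "\<dots> \<le> 2 * (cmod a)\<^sup>2 + 2 * (cmod b)\<^sup>2"
    using sum_squares_bound[of "cmod a" "cmod b"] by (simp add: power2_sum)
  finally show ?thesis .
qed

lemma L2_add:
  assumes "f \<in> L2" "g \<in> L2"
  shows "(\<lambda>x. f x + g x) \<in> L2"
  unfolding L2_iff
proof
  show m: "(\<lambda>x. f x + g x) \<in> borel_measurable unit_leb"
    using assms by (intro borel_measurable_add L2_measurable)
  show "integrable unit_leb (\<lambda>x. (cmod (f x + g x))\<^sup>2)"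
  proof (rule Bochner_Integration.integrable_bound[where f = "\<lambda>x. 2 * (cmod (f x))\<^sup>2 + 2 * (cmod (g x))\<^sup>2"])
    show "AE x in unit_leb. norm ((cmod (f x + g x))\<^sup>2) \<le> norm (2 * (cmod (f x))\<^sup>2 + 2 * (cmod (g x))\<^sup>2)"
      using norm_add_squared_le by simp
  qed (use assms m in \<open>auto simp: L2_iff\<close>)
qed

lemma L2_scale: "f \<in> L2 \<Longrightarrow> (\<lambda>x. c * f x) \<in> L2"
  by (auto simp: L2_iff norm_mult power_mult_distrib)

lemma L2_diff:
  assumes "f \<in> L2" "g \<in> L2"
  shows "(\<lambda>x. f x - g x) \<in> L2"
  using L2_add[OF assms(1) L2_scale[OF assms(2), of "-1"]] by simp

lemma L2_bounded:
  assumes m: "f \<in> borel_measurable unit_leb" and B: "\<And>x. x \<in> {0<..<1} \<Longrightarrow> cmod (f x) \<le> B"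
  shows "f \<in> L2"
  unfolding L2_iff
proof
  show "integrable unit_leb (\<lambda>x. (cmod (f x))\<^sup>2)"
  proof (rule Bochner_Integration.integrable_bound[OF integrable_unit_leb_const[of "B\<^sup>2"]])
    show "AE x in unit_leb. norm ((cmod (f x))\<^sup>2) \<le> norm (B\<^sup>2)"
    proof (rule AE_I2)
      fix x assume "x \<in> space unit_leb"
      then have "cmod (f x) \<le> B" using B by simp
      then show "norm ((cmod (f x))\<^sup>2) \<le> norm (B\<^sup>2)" by (simp add: power_mono)
    qed
  qed (use m in measurable)
qed (rule m)

lemma L2_const: "(\<lambda>x. c) \<in> L2"
  by (rule L2_bounded[of _ "cmod c"]) auto

lemma continuous_unit_measurable:
  fixes f :: "real \<Rightarrow> 'a :: euclidean_space"
  assumes "continuous_on {0..1} f"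
  shows "f \<in> borel_measurable unit_leb"
  by (intro continuous_imp_measurable_on_sets_lebesgue continuous_on_subset[OF assms]) auto

lemma L2_continuous:
  assumes f: "continuous_on {0..1} f"
  shows "f \<in> L2"
proof -
  have "compact (f ` {0..1})" using f by (intro compact_continuous_image) auto
  then obtain B where "\<And>x. x \<in> {0..1} \<Longrightarrow> cmod (f x) \<le> B"
    using compact_imp_bounded bounded_iff by (metis imageI)
  then show ?thesis
    by (intro L2_bounded[of _ B] continuous_unit_measurable f) auto
qed

lemma L2_integrable:
  assumes "f \<in> L2"
  shows "integrable unit_leb f"
  using L2_prod_integrable[OF assms L2_const[of 1]] by simp

lemma L2_inner_add_left:
  assumes "f \<in> L2" "g \<in> L2" "h \<in> L2"
  shows "L2_inner (\<lambda>x. f x + g x) h = L2_inner f h + L2_inner g h"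
  unfolding L2_inner_def using assms
  by (simp add: distrib_right L2_inner_integrable)

lemma L2_inner_scale_left: "L2_inner (\<lambda>x. c * f x) h = c * L2_inner f h"
  unfolding L2_inner_def by (simp add: mult.assoc)

lemma L2_inner_diff_left:
  assumes "f \<in> L2" "g \<in> L2" "h \<in> L2"
  shows "L2_inner (\<lambda>x. f x - g x) h = L2_inner f h - L2_inner g h"
  unfolding L2_inner_def using assms
  by (simp add: left_diff_distrib L2_inner_integrable)

lemma L2_inner_commute: "L2_inner g f = cnj (L2_inner f g)"
  unfolding L2_inner_def by (subst Bochner_Integration.integral_cnj[symmetric]) (simp add: mult.commute)

lemma L2_inner_sum_left:
  assumes "\<And>i. i \<in> A \<Longrightarrow> f i \<in> L2" "h \<in> L2"
  shows "L2_inner (\<lambda>x. \<Sum>i\<in>A. c i * f i x) h = (\<Sum>i\<in>A. c i * L2_inner (f i) h)"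
proof -
  have "L2_inner (\<lambda>x. \<Sum>i\<in>A. c i * f i x) h = (LINT x|unit_leb. (\<Sum>i\<in>A. c i * (f i x * cnj (h x))))"
    unfolding L2_inner_def by (simp add: sum_distrib_right mult.assoc)
  also have "\<dots> = (\<Sum>i\<in>A. c i * L2_inner (f i) h)"
    unfolding L2_inner_def using assms by (subst Bochner_Integration.integral_sum) (auto simp: L2_inner_integrable)
  finally show ?thesis .
qed

lemma L2_sum:
  assumes "\<And>i. i \<in> A \<Longrightarrow> f i \<in> L2"
  shows "(\<lambda>x. \<Sum>i\<in>A. c i * f i x) \<in> L2"
  using assms
proof (induction A rule: infinite_finite_induct)
  case (insert i A)
  then show ?case using L2_add[OF L2_scale[of "f i" "c i"]] by auto
qed (auto simp: L2_const)

lemma L2_inner_cong_AE: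
  assumes "f \<in> L2" "f' \<in> L2" "g \<in> L2" "AE x in unit_leb. f x = f' x"
  shows "L2_inner f g = L2_inner f' g"
  unfolding L2_inner_def
proof (rule integral_cong_AE)
  show "AE x in unit_leb. f x * cnj (g x) = f' x * cnj (g x)"
    using assms(4) by eventually_elim simp
qed (use assms in \<open>auto intro!: borel_measurable_integrable L2_inner_integrable\<close>)

definition sq_int :: "(real \<Rightarrow> complex) \<Rightarrow> real" where
  "sq_int f = (LINT x|unit_leb. (cmod (f x))\<^sup>2)"

lemma L2_inner_self: "L2_inner f f = of_real (sq_int f)"
  unfolding L2_inner_def sq_int_def
  by (simp only: complex_norm_square[symmetric] integral_complex_of_real)

lemma sq_int_nonneg: "0 \<le> sq_int f"
  unfolding sq_int_def by simp

lemma L2_norm_eq: "L2_norm f = sqrt (sq_int f)"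
  unfolding L2_norm_def L2_inner_self by simp

lemma sq_int_eq_0_iff:
  assumes "f \<in> L2"
  shows "sq_int f = 0 \<longleftrightarrow> (AE x in unit_leb. f x = 0)"
  unfolding sq_int_def using assms
  by (subst integral_nonneg_eq_0_iff_AE) (auto simp: L2_iff)

lemma FTC_unit_leb:
  fixes F :: "real \<Rightarrow> complex"
  assumes F: "\<And>x. x \<in> {0..1} \<Longrightarrow> (F has_vector_derivative f x) (at x within {0..1})"
    and f: "continuous_on {0..1} f"
  shows "(LINT x|unit_leb. f x) = F 1 - F 0"
proof -
  have "integrable unit_leb f" using L2_integrable[OF L2_continuous[OF f]] .
  then have "(LINT x|unit_leb. f x) = integral {0<..<1} f"
    by (intro lebesgue_integral_eq_integral) auto
  also have "\<dots> = integral {0..1} f" by (simp add: integral_open_interval_real)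
  also have "\<dots> = F 1 - F 0"
    by (intro integral_unique fundamental_theorem_of_calculus F) auto
  finally show ?thesis .
qed

section \<open>The exponential basis and its coefficients\<close>

definition fmode :: "int \<Rightarrow> real \<Rightarrow> complex" where
  "fmode n x = cis (2 * pi * real_of_int n * x)"

definition fcoef :: "(real \<Rightarrow> complex) \<Rightarrow> int \<Rightarrow> complex" where
  "fcoef f n = L2_inner f (fmode n)"

lemma fmode_deriv:
  "(fmode n has_vector_derivative (2 * pi * \<i> * of_int n) * fmode n x) (at x within S)"
proof -
  have "((\<lambda>z. exp ((2 * pi * \<i> * of_int n) * z)) has_field_derivative
      (2 * pi * \<i> * of_int n) * exp ((2 * pi * \<i> * of_int n) * of_real x)) (at (of_real x))"
    by (auto intro!: derivative_eq_intros)
  then have "((\<lambda>x. exp ((2 * pi * \<i> * of_int n) * of_real x)) has_vector_derivative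
      (2 * pi * \<i> * of_int n) * exp ((2 * pi * \<i> * of_int n) * of_real x)) (at x within S)"
    by (rule has_vector_derivative_real_field)
  then show ?thesis by (simp add: fmode_def[abs_def] cis_conv_exp mult_ac)
qed

lemma fmode_continuous: "continuous_on S (fmode n)"
  unfolding fmode_def by (intro continuous_intros)

lemma fmode_L2: "fmode n \<in> L2"
  by (intro L2_continuous fmode_continuous)

lemma norm_fmode [simp]: "cmod (fmode n x) = 1"
  by (simp add: fmode_def)

lemma fmode_at_0 [simp]: "fmode n 0 = 1"
  by (simp add: fmode_def)

lemma fmode_at_1 [simp]: "fmode n 1 = 1"
  using cis_multiple_2pi[of "real_of_int n"] by (simp add: fmode_def mult_ac)

lemma fmode_0 [simp]: "fmode 0 x = 1"
  by (simp add: fmode_def)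

lemma fmode_mult: "fmode m x * fmode n x = fmode (m + n) x"
  by (simp add: fmode_def cis_mult algebra_simps)

lemma cnj_fmode: "cnj (fmode n x) = fmode (- n) x"
  by (simp add: fmode_def cis_cnj)

lemma integral_fmode: "(LINT x|unit_leb. fmode n x) = (if n = 0 then 1 else 0)"
proof (cases "n = 0")
  case True
  then show ?thesis using measure_unit_leb_space by simp
next
  case False
  have "(LINT x|unit_leb. (2 * pi * \<i> * of_int n) * fmode n x) = fmode n 1 - fmode n 0"
    by (intro FTC_unit_leb fmode_deriv continuous_intros fmode_continuous)
  then show ?thesis using False by simp
qed

lemma L2_inner_fmode: "L2_inner (fmode m) (fmode n) = (if m = n then 1 else 0)"
  unfolding L2_inner_def by (simp add: cnj_fmode fmode_mult integral_fmode)

lemma fcoef_trig_poly: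
  assumes "finite A"
  shows "fcoef (\<lambda>x. \<Sum>m\<in>A. c m * fmode m x) n = (if n \<in> A then c n else 0)"
proof -
  have "fcoef (\<lambda>x. \<Sum>m\<in>A. c m * fmode m x) n = (\<Sum>m\<in>A. c m * (if m = n then 1 else 0))"
    unfolding fcoef_def by (simp add: L2_inner_sum_left fmode_L2 L2_inner_fmode)
  also have "\<dots> = (\<Sum>m\<in>A. if m = n then c m else 0)"
    by (intro sum.cong) auto
  finally show ?thesis using assms by simp
qed

text \<open>Completing the square in the coefficients. The choice \<open>c = fcoef f\<close> yields
  Bessel's inequality; a general \<open>c\<close> shows that no other combination of the modes in
  \<open>A\<close> is closer to \<open>f\<close>.\<close>

lemma sq_int_diff_trig_poly:
  assumes f: "f \<in> L2" and A: "finite A"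
  shows "sq_int (\<lambda>x. f x - (\<Sum>n\<in>A. c n * fmode n x))
    = sq_int f - (\<Sum>n\<in>A. (cmod (fcoef f n))\<^sup>2) + (\<Sum>n\<in>A. (cmod (fcoef f n - c n))\<^sup>2)"
proof -
  define p where "p x = (\<Sum>n\<in>A. c n * fmode n x)" for x
  have p: "p \<in> L2" unfolding p_def by (rule L2_sum) (rule fmode_L2)
  have fp: "(\<lambda>x. f x - p x) \<in> L2" using f p by (rule L2_diff)
  have pg: "L2_inner p g = (\<Sum>n\<in>A. c n * cnj (fcoef g n))" if "g \<in> L2" for g
    unfolding p_def fcoef_def using that
    by (subst L2_inner_sum_left) (auto simp: fmode_L2 intro!: sum.cong L2_inner_commute)
  have pp: "L2_inner p p = (\<Sum>n\<in>A. c n * cnj (c n))"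
  proof -
    have "fcoef p n = c n" if "n \<in> A" for n
      using fcoef_trig_poly[OF A, of c n] that by (simp add: p_def[abs_def])
    then show ?thesis using pg[OF p] by simp
  qed
  have "L2_inner (\<lambda>x. f x - p x) (\<lambda>x. f x - p x)
     = L2_inner f (\<lambda>x. f x - p x) - L2_inner p (\<lambda>x. f x - p x)"
    using f p fp by (rule L2_inner_diff_left)
  also have "\<dots> = cnj (L2_inner f f - L2_inner p f) - cnj (L2_inner f p - L2_inner p p)"
    using L2_inner_commute[of _ "\<lambda>x. f x - p x"] f p by (simp add: L2_inner_diff_left)
  also have "\<dots> = L2_inner f f - (cnj (L2_inner p f) + L2_inner p f) + L2_inner p p"
    using L2_inner_commute[of p f] L2_inner_commute[of f f] L2_inner_commute[of p p] by simp
  also have "\<dots> = L2_inner f f - (\<Sum>n\<in>A. fcoef f n * cnj (fcoef f n))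
     + (\<Sum>n\<in>A. (fcoef f n - c n) * cnj (fcoef f n - c n))"
    unfolding pg[OF f] pp by (simp add: algebra_simps sum.distrib sum_subtractf)
  also have "\<dots> = of_real (sq_int f - (\<Sum>n\<in>A. (cmod (fcoef f n))\<^sup>2) + (\<Sum>n\<in>A. (cmod (fcoef f n - c n))\<^sup>2))"
    by (simp only: L2_inner_self complex_norm_square[symmetric] of_real_sum of_real_diff of_real_add)
  finally show ?thesis unfolding L2_inner_self p_def of_real_eq_iff .
qed

section \<open>Density of trigonometric polynomials\<close>

definition trig_poly :: "(real \<Rightarrow> complex) \<Rightarrow> bool" where
  "trig_poly p \<longleftrightarrow> (\<exists>A c. finite A \<and> p = (\<lambda>x. \<Sum>n\<in>A. c n * fmode n x))"

lemma trig_poly_scaled_mode: "trig_poly (\<lambda>x. a * fmode n x)"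
  unfolding trig_poly_def by (rule exI[of _ "{n}"], rule exI[of _ "\<lambda>_. a"]) auto

lemma trig_poly_add:
  assumes "trig_poly p" "trig_poly q"
  shows "trig_poly (\<lambda>x. p x + q x)"
proof -
  obtain A c where A: "finite A" "p = (\<lambda>x. \<Sum>n\<in>A. c n * fmode n x)"
    using assms(1) by (auto simp: trig_poly_def)
  obtain B d where B: "finite B" "q = (\<lambda>x. \<Sum>n\<in>B. d n * fmode n x)"
    using assms(2) by (auto simp: trig_poly_def)
  have "p x + q x = (\<Sum>n\<in>A\<union>B. ((if n \<in> A then c n else 0) + (if n \<in> B then d n else 0)) * fmode n x)" for x
  proof -
    have "p x = (\<Sum>n\<in>A\<union>B. (if n \<in> A then c n else 0) * fmode n x)"
      unfolding A(2) using A(1) B(1) by (intro sum.mono_neutral_cong_left) auto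
    moreover have "q x = (\<Sum>n\<in>A\<union>B. (if n \<in> B then d n else 0) * fmode n x)"
      unfolding B(2) using A(1) B(1) by (intro sum.mono_neutral_cong_left) auto
    ultimately show ?thesis by (simp add: sum.distrib distrib_right)
  qed
  then show ?thesis unfolding trig_poly_def using A(1) B(1) by (intro exI[of _ "A \<union> B"]) auto
qed

lemma trig_poly_sum:
  assumes "finite A" "\<And>i. i \<in> A \<Longrightarrow> trig_poly (p i)"
  shows "trig_poly (\<lambda>x. \<Sum>i\<in>A. p i x)"
  using assms
proof (induction A rule: finite_induct)
  case empty
  then show ?case using trig_poly_scaled_mode[of 0 0] by simp
next
  case (insert i A)
  then show ?case using trig_poly_add[of "p i" "\<lambda>x. \<Sum>i\<in>A. p i x"] by simp
qed

lemma trig_poly_mult: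
  assumes "trig_poly p" "trig_poly q"
  shows "trig_poly (\<lambda>x. p x * q x)"
proof -
  obtain A c where A: "finite A" "p = (\<lambda>x. \<Sum>n\<in>A. c n * fmode n x)"
    using assms(1) by (auto simp: trig_poly_def)
  obtain B d where B: "finite B" "q = (\<lambda>x. \<Sum>n\<in>B. d n * fmode n x)"
    using assms(2) by (auto simp: trig_poly_def)
  have "p x * q x = (\<Sum>m\<in>A. \<Sum>n\<in>B. c m * d n * fmode (m + n) x)" for x
    by (simp add: A(2) B(2) sum_product mult_ac flip: fmode_mult)
  then have "(\<lambda>x. p x * q x) = (\<lambda>x. \<Sum>m\<in>A. \<Sum>n\<in>B. c m * d n * fmode (m + n) x)" by auto
  then show ?thesis
    using A(1) B(1) by (simp add: trig_poly_sum trig_poly_scaled_mode)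
qed

lemma trig_poly_const: "trig_poly (\<lambda>x. a)"
  using trig_poly_scaled_mode[of a 0] by simp

text \<open>On the circle a real linear function is a combination of \<open>cos\<close> and
  \<open>sin\<close>, hence of the modes 1 and -1; sums and products of trigonometric polynomials
  cover the remaining cases of the induction.\<close>

lemma trig_poly_real_polynomial:
  fixes f :: "complex \<Rightarrow> real"
  assumes "real_polynomial_function f"
  shows "trig_poly (\<lambda>x. of_real (f (cis (2 * pi * x))))"
  using assms
proof induction
  case (linear f)
  have "complex_of_real (f (cis t)) = of_real (f 1) * of_real (cos t) + of_real (f \<i>) * of_real (sin t)" for t
  proof -
    have "f (cis t) = f (cos t *\<^sub>R 1 + sin t *\<^sub>R \<i>)"
      by (rule arg_cong[of _ _ f]) (simp add: complex_eq_iff)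
    also have "\<dots> = cos t * f 1 + sin t * f \<i>"
      using linear by (simp add: bounded_linear.linear linear_add linear_scale)
    finally show ?thesis by (simp add: mult.commute)
  qed
  moreover have "of_real (cos (2 * pi * x)) = 1/2 * fmode 1 x + 1/2 * fmode (-1) x"
    "of_real (sin (2 * pi * x)) = (-\<i>/2) * fmode 1 x + (\<i>/2) * fmode (-1) x" for x
    by (auto simp: fmode_def complex_eq_iff)
  ultimately show ?case
    by (simp only:) (intro trig_poly_add trig_poly_mult trig_poly_const trig_poly_scaled_mode)
qed (auto simp: trig_poly_const trig_poly_add trig_poly_mult)

text \<open>Equal end values let \<open>g\<close> descend to the unit circle, where the
  Stone-Weierstrass theorem for polynomial functions applies.\<close>

lemma trig_poly_uniform_dense:
  assumes g: "continuous_on {0..1} g" "g 0 = g 1" and e: "e > 0"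
  shows "\<exists>p. trig_poly p \<and> (\<forall>x\<in>{0..1}. cmod (g x - p x) < e)"
proof -
  define q where "q t = cis (2 * pi * t)" for t :: real
  \<comment> \<open>\<open>Arg2pi\<close> jumps at the point 1, so this formula does not show that
    \<psi> is continuous. Continuity comes from \<open>g\<close>, because \<open>q\<close> is a
    quotient map from a compact space onto a Hausdorff space.\<close>
  define \<psi> where "\<psi> w = g (Arg2pi w / (2 * pi))" for w
  have \<psi>q: "\<psi> (q t) = g t" if t: "t \<in> {0..1}" for t
  proof (cases "t = 1")
    case True
    moreover have "Arg2pi 1 = 0" by (intro Arg2pi_unique[of 1]) auto
    ultimately show ?thesis using g(2) by (simp add: \<psi>_def q_def)
  next
    case False
    then have "Arg2pi (q t) = 2 * pi * t"
      using t by (intro Arg2pi_unique[of 1]) (auto simp: q_def cis_conv_exp mult.commute)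
    then show ?thesis by (simp add: \<psi>_def)
  qed
  have q_cont: "continuous_on {0..1} q" unfolding q_def by (intro continuous_intros)
  have q_img: "q ` {0..1} = sphere 0 1"
  proof
    show "sphere 0 1 \<subseteq> q ` {0..1}"
    proof
      fix w :: complex assume "w \<in> sphere 0 1"
      then have "w = q (Arg2pi w / (2 * pi))"
        using Arg2pi_eq[of w] by (simp add: q_def cis_conv_exp mult.commute)
      moreover have "Arg2pi w / (2 * pi) \<in> {0..1}"
        using Arg2pi_ge_0[of w] Arg2pi_lt_2pi[of w] by simp
      ultimately show "w \<in> q ` {0..1}" by (rule image_eqI)
    qed
  qed (auto simp: q_def)
  have "quotient_map (top_of_set {0..1}) (top_of_set (sphere 0 1)) q"
    by (rule T1_Spaces.continuous_imp_quotient_map)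
      (use q_cont q_img in \<open>auto simp: Hausdorff_space_subtopology compact_space_subtopology\<close>)
  moreover have "continuous_map (top_of_set {0..1}) euclidean (\<psi> \<circ> q)"
    using continuous_on_cong[of "{0..1}" "{0..1}" "\<psi> \<circ> q" g] g(1) \<psi>q by simp
  ultimately have "continuous_map (top_of_set (sphere 0 1)) euclidean \<psi>"
    by (rule continuous_compose_quotient_map)
  then have "continuous_on (sphere 0 1) \<psi>" by simp
  then obtain G where G: "polynomial_function G" "\<And>w. w \<in> sphere 0 1 \<Longrightarrow> cmod (\<psi> w - G w) < e"
    using Stone_Weierstrass_polynomial_function[of "sphere 0 1" \<psi> e] e compact_sphere by metis
  have "real_polynomial_function (Re \<circ> G)" "real_polynomial_function (Im \<circ> G)"
    using G(1) bounded_linear_Re bounded_linear_Im unfolding polynomial_function_def by blast+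
  then have "trig_poly (\<lambda>x. of_real (Re (G (q x))) + \<i> * of_real (Im (G (q x))))"
    unfolding q_def by (intro trig_poly_add trig_poly_mult trig_poly_const)
     (use trig_poly_real_polynomial[of "Re \<circ> G"] trig_poly_real_polynomial[of "Im \<circ> G"] in auto)
  then have "trig_poly (\<lambda>x. G (q x))" by (simp flip: complex_eq)
  moreover have "cmod (g x - G (q x)) < e" if "x \<in> {0..1}" for x
    using G(2)[of "q x"] \<psi>q[OF that] by (simp add: q_def)
  ultimately show ?thesis by blast
qed

text \<open>For \<open>M > 0\<close> this is the radial retraction onto the closed disc of radius
  \<open>M\<close>. It is continuous, so truncating continuous approximants keeps them
  continuous.\<close>

definition truncate :: "real \<Rightarrow> complex \<Rightarrow> complex" where
  "truncate M w = w / of_real (max 1 (cmod w / M))"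

lemma truncate_id: "M > 0 \<Longrightarrow> cmod w \<le> M \<Longrightarrow> truncate M w = w"
  by (simp add: truncate_def max_def)

lemma norm_truncate_le:
  assumes "M > 0"
  shows "cmod (truncate M w) \<le> M"
proof -
  have "cmod w \<le> M * max 1 (cmod w / M)"
    using assms by (simp add: max_def field_simps)
  moreover have "0 < max 1 (cmod w / M)" by (simp add: less_max_iff_disj)
  ultimately show ?thesis
    by (simp add: truncate_def norm_divide divide_le_eq)
qed

lemma norm_diff_truncate_le: "cmod (w - truncate M w) \<le> cmod w"
proof -
  define t where "t = 1 / max 1 (cmod w / M)"
  have t: "0 \<le> t" "t \<le> 1" by (auto simp: t_def)
  have "w - truncate M w = of_real (1 - t) * w"
    by (simp add: truncate_def t_def algebra_simps)
  then have "cmod (w - truncate M w) = (1 - t) * cmod w"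
    using t by (simp only: norm_mult norm_of_real)
  also have "\<dots> \<le> cmod w" using t by (simp add: mult_left_le_one_le)
  finally show ?thesis .
qed

lemma truncate_continuous: "continuous_on S (truncate M)"
proof -
  have "max 1 (cmod x / M) \<noteq> 0" for x by (metis max.cobounded1 not_one_le_zero)
  then have "continuous_on S (\<lambda>w. w / complex_of_real (max 1 (cmod w * inverse M)))"
    by (intro continuous_intros) (auto simp: divide_inverse)
  then show ?thesis by (simp add: truncate_def[abs_def] divide_inverse[of "cmod _" M])
qed

lemma truncate_measurable [measurable]: "truncate M \<in> borel_measurable borel"
  by (intro borel_measurable_continuous_onI truncate_continuous)

lemma truncate_L2_approx:
  assumes f: "f \<in> L2" and e: "e > 0"
  shows "\<exists>M>0. sq_int (\<lambda>x. f x - truncate M (f x)) < e"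
proof -
  have fm[measurable]: "f \<in> borel_measurable unit_leb" using f by (rule L2_measurable)
  have "(\<lambda>m. LINT x|unit_leb. (cmod (f x - truncate (real (Suc m)) (f x)))\<^sup>2) \<longlonglongrightarrow> (LINT x|unit_leb. 0)"
  proof (rule integral_dominated_convergence[where w = "\<lambda>x. (cmod (f x))\<^sup>2"])
    show "AE x in unit_leb. (\<lambda>m. (cmod (f x - truncate (real (Suc m)) (f x)))\<^sup>2) \<longlonglongrightarrow> 0"
    proof (rule AE_I2)
      fix x
      have "\<forall>\<^sub>F m in sequentially. cmod (f x) \<le> real m"
        using filterlim_real_sequentially by (simp add: filterlim_at_top)
      then have "\<forall>\<^sub>F m in sequentially. (cmod (f x - truncate (real (Suc m)) (f x)))\<^sup>2 = 0"
        by eventually_elim (simp add: truncate_id)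
      then show "(\<lambda>m. (cmod (f x - truncate (real (Suc m)) (f x)))\<^sup>2) \<longlonglongrightarrow> 0"
        by (rule tendsto_eventually)
    qed
    show "AE x in unit_leb. norm ((cmod (f x - truncate (real (Suc m)) (f x)))\<^sup>2) \<le> (cmod (f x))\<^sup>2" for m
      using norm_diff_truncate_le by (simp add: power_mono)
  qed (use f in \<open>auto simp: L2_iff\<close>)
  then have "\<forall>\<^sub>F m in sequentially. sq_int (\<lambda>x. f x - truncate (real (Suc m)) (f x)) < e"
    using e order_tendstoD(2) by (fastforce simp: sq_int_def)
  then obtain m where "sq_int (\<lambda>x. f x - truncate (real (Suc m)) (f x)) < e"
    using eventually_happens by fastforce
  then show ?thesis by (intro exI[of _ "real (Suc m)"]) auto
qed

lemma AE_unit_leb_not_negligible: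
  assumes "negligible N"
  shows "AE x in unit_leb. x \<notin> N"
proof -
  have "AE x in lebesgue. x \<notin> N"
    using assms by (intro AE_not_in) (simp add: negligible_iff_null_sets)
  then show ?thesis by (subst AE_restrict_space_iff) auto
qed

text \<open>Measurability supplies continuous \<open>G n\<close> that converge to \<open>f\<close>
  almost everywhere. Truncation at the same level \<open>B\<close> gives them a common bound, and
  dominated convergence upgrades this to convergence in mean square.\<close>

lemma bounded_L2_approx_continuous:
  assumes f: "f \<in> borel_measurable unit_leb" and B: "B > 0" and e: "e > 0"
  shows "\<exists>g. continuous_on UNIV g \<and> g 0 = 0 \<and> g 1 = 0 \<and> sq_int (\<lambda>x. truncate B (f x) - g x) < e"
proof -
  have "f measurable_on {0<..<1}"
    using f by (subst measurable_on_iff_borel_measurable) auto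
  then obtain N G where N: "negligible N" and G: "\<And>n. continuous_on UNIV (G n)"
    and lim: "\<And>x. x \<notin> N \<Longrightarrow> (\<lambda>n. G n x) \<longlonglongrightarrow> (if x \<in> {0<..<1} then f x else 0)"
    unfolding measurable_on_def by blast
  \<comment> \<open>This factor tends to 1 inside the interval and vanishes at both ends; the equal
    end values are what uniform approximation by trigonometric polynomials requires.\<close>
  define cut where "cut n x = min 1 (real n * (x * (1 - x)))" for n x
  define k where "k n x = of_real (cut n x) * truncate B (G n x)" for n x
  have k_cont: "continuous_on UNIV (k n)" for n
    unfolding k_def cut_def
    by (intro continuous_intros continuous_on_compose2[OF truncate_continuous[of UNIV B] G]) auto
  have k_meas: "k n \<in> borel_measurable unit_leb" for n
    by (rule continuous_unit_measurable) (use k_cont continuous_on_subset in blast)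
  have k_bd: "cmod (k n x) \<le> B" if "x \<in> {0<..<1}" for n x
  proof -
    have "\<bar>cut n x\<bar> \<le> 1" using that by (simp add: cut_def)
    then have "\<bar>cut n x\<bar> * cmod (truncate B (G n x)) \<le> 1 * B"
      using norm_truncate_le[OF B] by (intro mult_mono) auto
    then show ?thesis by (simp add: k_def norm_mult)
  qed
  have tf_meas: "(\<lambda>x. truncate B (f x)) \<in> borel_measurable unit_leb"
    using f by measurable
  have "(\<lambda>n. LINT x|unit_leb. (cmod (truncate B (f x) - k n x))\<^sup>2) \<longlonglongrightarrow> (LINT x|unit_leb. 0)"
  proof (rule integral_dominated_convergence[where w = "\<lambda>x. (2 * B)\<^sup>2"])
    have "AE x in unit_leb. x \<in> space unit_leb" by (rule AE_space)
    with AE_unit_leb_not_negligible[OF N]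
    show "AE x in unit_leb. (\<lambda>n. (cmod (truncate B (f x) - k n x))\<^sup>2) \<longlonglongrightarrow> 0"
    proof eventually_elim
      case (elim x)
      then have x: "x \<in> {0<..<1}" by simp
      then have "(\<lambda>n. G n x) \<longlonglongrightarrow> f x" using lim[of x] elim by simp
      moreover have "isCont (truncate B) (f x)"
        using truncate_continuous[of UNIV B] by (simp add: continuous_on_eq_continuous_at)
      ultimately have 1: "(\<lambda>n. truncate B (G n x)) \<longlonglongrightarrow> truncate B (f x)"
        by (rule isCont_tendsto_compose[rotated])
      have "x * (1 - x) > 0" using x by simp
      then have "\<forall>\<^sub>F n in sequentially. 1 / (x * (1 - x)) \<le> real n"
        using filterlim_real_sequentially by (simp add: filterlim_at_top)
      then have "\<forall>\<^sub>F n in sequentially. cut n x = 1"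
        by eventually_elim (use \<open>x * (1 - x) > 0\<close> in \<open>simp add: cut_def field_simps\<close>)
      then have "(\<lambda>n. complex_of_real (cut n x)) \<longlonglongrightarrow> 1"
        by (intro tendsto_eventually) (auto elim: eventually_mono)
      from tendsto_mult[OF this 1] have "(\<lambda>n. k n x) \<longlonglongrightarrow> truncate B (f x)" by (simp add: k_def)
      from tendsto_diff[OF tendsto_const[of "truncate B (f x)"] this]
      have "(\<lambda>n. truncate B (f x) - k n x) \<longlonglongrightarrow> 0" by simp
      then have "(\<lambda>n. (cmod (truncate B (f x) - k n x))\<^sup>2) \<longlonglongrightarrow> (cmod 0)\<^sup>2"
        by (intro tendsto_intros)
      then show ?case by simp
    qed
    show "AE x in unit_leb. norm ((cmod (truncate B (f x) - k n x))\<^sup>2) \<le> (2 * B)\<^sup>2" for n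
    proof (rule AE_I2)
      fix x assume "x \<in> space unit_leb"
      then have "cmod (truncate B (f x) - k n x) \<le> 2 * B"
        using norm_triangle_ineq4[of "truncate B (f x)" "k n x"] norm_truncate_le[OF B, of "f x"] k_bd[of x n] by simp
      then show "norm ((cmod (truncate B (f x) - k n x))\<^sup>2) \<le> (2 * B)\<^sup>2"
        using power_mono[of "cmod (truncate B (f x) - k n x)" "2 * B" 2] by simp
    qed
    show "integrable unit_leb (\<lambda>x. (2 * B)\<^sup>2)" by (rule integrable_unit_leb_const)
    show "(\<lambda>x. (cmod (truncate B (f x) - k n x))\<^sup>2) \<in> borel_measurable unit_leb" for n
      using tf_meas k_meas by measurable
  qed auto
  then have "\<forall>\<^sub>F n in sequentially. sq_int (\<lambda>x. truncate B (f x) - k n x) < e"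
    using e order_tendstoD(2) by (fastforce simp: sq_int_def)
  then obtain n where "sq_int (\<lambda>x. truncate B (f x) - k n x) < e"
    using eventually_happens by fastforce
  then show ?thesis using k_cont by (intro exI[of _ "k n"]) (auto simp: k_def cut_def)
qed

lemma sq_int_add_le:
  assumes "f \<in> L2" "g \<in> L2"
  shows "sq_int (\<lambda>x. f x + g x) \<le> 2 * sq_int f + 2 * sq_int g"
proof -
  have "sq_int (\<lambda>x. f x + g x) \<le> (LINT x|unit_leb. 2 * (cmod (f x))\<^sup>2 + 2 * (cmod (g x))\<^sup>2)"
    unfolding sq_int_def using assms L2_add[OF assms]
    by (intro integral_mono norm_add_squared_le) (auto simp: L2_iff)
  also have "\<dots> = 2 * sq_int f + 2 * sq_int g"
    unfolding sq_int_def using assms by (simp add: L2_iff)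
  finally show ?thesis .
qed

lemma L2_approx_continuous:
  assumes f: "f \<in> L2" and e: "e > 0"
  shows "\<exists>g. continuous_on UNIV g \<and> g 0 = 0 \<and> g 1 = 0 \<and> sq_int (\<lambda>x. f x - g x) < e"
proof -
  obtain B where B: "B > 0" "sq_int (\<lambda>x. f x - truncate B (f x)) < e / 4"
    using truncate_L2_approx[OF f, of "e / 4"] e by auto
  obtain g where g: "continuous_on UNIV g" "g 0 = 0" "g 1 = 0"
     "sq_int (\<lambda>x. truncate B (f x) - g x) < e / 4"
    using bounded_L2_approx_continuous[OF L2_measurable[OF f] B(1), of "e / 4"] e by auto
  have tf: "(\<lambda>x. truncate B (f x)) \<in> L2"
    by (rule L2_bounded[of _ B]) (use L2_measurable[OF f] norm_truncate_le[OF B(1)] in auto)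
  have g2: "g \<in> L2" using g(1) by (intro L2_continuous) (rule continuous_on_subset, auto)
  have "sq_int (\<lambda>x. f x - g x) = sq_int (\<lambda>x. (f x - truncate B (f x)) + (truncate B (f x) - g x))"
    by simp
  also have "\<dots> \<le> 2 * sq_int (\<lambda>x. f x - truncate B (f x)) + 2 * sq_int (\<lambda>x. truncate B (f x) - g x)"
    by (intro sq_int_add_le L2_diff f tf g2)
  also have "\<dots> < e" using B(2) g(4) by simp
  finally show ?thesis using g by blast
qed

lemma trig_poly_L2:
  assumes "trig_poly p"
  shows "p \<in> L2"
  using assms unfolding trig_poly_def by (auto intro!: L2_sum fmode_L2)

lemma sq_int_le_bound:
  assumes f: "f \<in> L2" and B: "\<And>x. x \<in> {0<..<1} \<Longrightarrow> cmod (f x) \<le> B"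
  shows "sq_int f \<le> B\<^sup>2"
proof -
  have "sq_int f \<le> (LINT x|unit_leb. B\<^sup>2)"
    unfolding sq_int_def using f B
    by (intro integral_mono) (auto simp: L2_iff integrable_unit_leb_const intro!: power_mono)
  then show ?thesis by (simp only: integral_unit_leb_const)
qed

lemma trig_poly_L2_dense:
  assumes f: "f \<in> L2" and e: "e > 0"
  shows "\<exists>p. trig_poly p \<and> sq_int (\<lambda>x. f x - p x) < e"
proof -
  obtain g where g: "continuous_on UNIV g" "g 0 = 0" "g 1 = 0" "sq_int (\<lambda>x. f x - g x) < e / 4"
    using L2_approx_continuous[OF f, of "e / 4"] e by auto
  have gc: "continuous_on {0..1} g" using g(1) by (rule continuous_on_subset) auto
  \<comment> \<open>Each squared distance is doubled when the two errors are added, so the total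
    stays below \<open>2 * e/4 + 2 * e/8\<close>, which is less than \<open>e\<close>.\<close>
  define d where "d = sqrt (e / 8)"
  have d: "d > 0" "d\<^sup>2 = e / 8" using e by (auto simp: d_def)
  obtain p where p: "trig_poly p" "\<And>x. x \<in> {0..1} \<Longrightarrow> cmod (g x - p x) < d"
    using trig_poly_uniform_dense[OF gc _ d(1)] g by auto
  have gp: "(\<lambda>x. g x - p x) \<in> L2" by (intro L2_diff L2_continuous gc trig_poly_L2 p)
  have "sq_int (\<lambda>x. g x - p x) \<le> d\<^sup>2"
    using p(2) by (intro sq_int_le_bound gp) (simp add: less_imp_le)
  moreover have "sq_int (\<lambda>x. (f x - g x) + (g x - p x)) \<le> 2 * sq_int (\<lambda>x. f x - g x) + 2 * sq_int (\<lambda>x. g x - p x)"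
    by (intro sq_int_add_le gp L2_diff f L2_continuous gc)
  ultimately have "sq_int (\<lambda>x. f x - p x) < e" using g(4) d(2) e by simp
  then show ?thesis using p(1) by blast
qed

section \<open>Parseval's identity and uniqueness of Fourier coefficients\<close>

lemma bessel_finite:
  assumes f: "f \<in> L2" and A: "finite A"
  shows "(\<Sum>n\<in>A. (cmod (fcoef f n))\<^sup>2) \<le> sq_int f"
  using sq_int_diff_trig_poly[OF f A, of "fcoef f"] sq_int_nonneg[of "\<lambda>x. f x - (\<Sum>n\<in>A. fcoef f n * fmode n x)"]
  by simp

text \<open>A trigonometric polynomial close to \<open>f\<close> bounds the defect of the partial
  sum over its own index set. Enlarging the set only lowers the defect, and Bessel's inequality
  keeps it nonnegative.\<close>

lemma parseval:
  assumes f: "f \<in> L2"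
  shows "((\<lambda>n. (cmod (fcoef f n))\<^sup>2) has_sum sq_int f) UNIV"
  unfolding has_sum_def tendsto_iff
proof (intro allI impI)
  fix e :: real assume e: "e > 0"
  obtain p where "trig_poly p" and lt: "sq_int (\<lambda>x. f x - p x) < e"
    using trig_poly_L2_dense[OF f e] by blast
  then obtain A c where A: "finite A" and p: "p = (\<lambda>x. \<Sum>n\<in>A. c n * fmode n x)"
    by (auto simp: trig_poly_def)
  have "0 \<le> (\<Sum>n\<in>A. (cmod (fcoef f n - c n))\<^sup>2)" by (intro sum_nonneg) auto
  then have close: "sq_int f - (\<Sum>n\<in>A. (cmod (fcoef f n))\<^sup>2) < e"
    using lt sq_int_diff_trig_poly[OF f A, of c] unfolding p by linarith
  show "\<forall>\<^sub>F X in finite_subsets_at_top UNIV. dist (\<Sum>n\<in>X. (cmod (fcoef f n))\<^sup>2) (sq_int f) < e"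
    unfolding eventually_finite_subsets_at_top
  proof (intro exI[of _ A] conjI allI impI)
    fix X assume X: "finite X \<and> A \<subseteq> X \<and> X \<subseteq> (UNIV :: int set)"
    then have "(\<Sum>n\<in>A. (cmod (fcoef f n))\<^sup>2) \<le> (\<Sum>n\<in>X. (cmod (fcoef f n))\<^sup>2)"
      by (intro sum_mono2) auto
    then show "dist (\<Sum>n\<in>X. (cmod (fcoef f n))\<^sup>2) (sq_int f) < e"
      using close bessel_finite[OF f, of X] X by (simp add: dist_real_def)
  qed (use A in auto)
qed

lemma fcoef_diff:
  assumes "f \<in> L2" "g \<in> L2"
  shows "fcoef (\<lambda>x. f x - g x) n = fcoef f n - fcoef g n"
  unfolding fcoef_def using assms by (intro L2_inner_diff_left fmode_L2)

lemma fcoef_add: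
  assumes "f \<in> L2" "g \<in> L2"
  shows "fcoef (\<lambda>x. f x + g x) n = fcoef f n + fcoef g n"
  unfolding fcoef_def using assms by (intro L2_inner_add_left fmode_L2)

lemma fcoef_scale: "fcoef (\<lambda>x. c * f x) n = c * fcoef f n"
  unfolding fcoef_def by (rule L2_inner_scale_left)

lemma fcoef_cong_AE:
  assumes "f \<in> L2" "g \<in> L2" "AE x in unit_leb. f x = g x"
  shows "fcoef f n = fcoef g n"
  unfolding fcoef_def using assms by (intro L2_inner_cong_AE fmode_L2)

lemma fcoef_eq_imp_AE:
  assumes f: "f \<in> L2" and g: "g \<in> L2" and eq: "\<And>n. fcoef f n = fcoef g n"
  shows "AE x in unit_leb. f x = g x"
proof -
  have fg: "(\<lambda>x. f x - g x) \<in> L2" using f g by (rule L2_diff)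
  have "((\<lambda>n. (cmod (fcoef (\<lambda>x. f x - g x) n))\<^sup>2) has_sum 0) UNIV"
    by (simp add: fcoef_diff[OF f g] eq)
  then have "sq_int (\<lambda>x. f x - g x) = 0"
    using parseval[OF fg] has_sum_unique by blast
  then have "AE x in unit_leb. f x - g x = 0"
    using sq_int_eq_0_iff[OF fg] by simp
  then show ?thesis by simp
qed

lemma norm_fcoef_le:
  assumes "f \<in> L2"
  shows "cmod (fcoef f n) \<le> sqrt (sq_int f)"
  using bessel_finite[OF assms, of "{n}"] by (simp add: real_le_rsqrt)

section \<open>Fourier series with absolutely summable coefficients\<close>

definition fseries :: "(int \<Rightarrow> complex) \<Rightarrow> real \<Rightarrow> complex" where
  "fseries y x = (\<Sum>\<^sub>\<infinity>n. y n * fmode n x)"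

lemma fseries_uniform_limit:
  assumes y: "(\<lambda>n. cmod (y n)) summable_on UNIV"
  shows "uniform_limit UNIV (\<lambda>X x. \<Sum>n\<in>X. y n * fmode n x) (fseries y) (finite_subsets_at_top UNIV)"
  unfolding fseries_def[abs_def]
  by (rule Weierstrass_m_test_general[OF _ y]) (simp add: norm_mult)

lemma fseries_continuous:
  assumes y: "(\<lambda>n. cmod (y n)) summable_on UNIV"
  shows "continuous_on UNIV (fseries y)"
  by (rule uniform_limit_theorem[OF _ fseries_uniform_limit[OF y]])
    (auto intro!: always_eventually continuous_intros fmode_continuous)

lemma fseries_L2:
  assumes y: "(\<lambda>n. cmod (y n)) summable_on UNIV"
  shows "fseries y \<in> L2"
  using fseries_continuous[OF y] by (intro L2_continuous) (rule continuous_on_subset, auto)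

lemma L2_inner_bound:
  assumes f: "f \<in> L2" and g: "g \<in> L2" and B: "\<And>x. x \<in> {0<..<1} \<Longrightarrow> cmod (f x) \<le> B"
  shows "cmod (L2_inner f g) \<le> B * (LINT x|unit_leb. cmod (g x))"
proof -
  have "cmod (L2_inner f g) \<le> (LINT x|unit_leb. cmod (f x * cnj (g x)))"
    unfolding L2_inner_def by (rule integral_norm_bound)
  also have "\<dots> \<le> (LINT x|unit_leb. B * cmod (g x))"
  proof (rule integral_mono)
    show "integrable unit_leb (\<lambda>x. cmod (f x * cnj (g x)))"
      using L2_inner_integrable[OF f g] by (rule integrable_norm)
    show "integrable unit_leb (\<lambda>x. B * cmod (g x))"
      using L2_integrable[OF g] by simp
    show "cmod (f x * cnj (g x)) \<le> B * cmod (g x)" if "x \<in> space unit_leb" for x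
      using B[of x] that by (simp add: norm_mult mult_right_mono)
  qed
  finally show ?thesis by simp
qed

text \<open>The series converges uniformly, and replacing it by a partial sum changes the inner
  product by at most the uniform error times the integral of \<open>|v|\<close>.\<close>

lemma fseries_inner:
  assumes y: "(\<lambda>n. cmod (y n)) summable_on UNIV" and v: "v \<in> L2"
  shows "((\<lambda>n. y n * cnj (fcoef v n)) has_sum L2_inner (fseries y) v) UNIV"
  unfolding has_sum_def tendsto_iff
proof (intro allI impI)
  fix e :: real assume e: "e > 0"
  define K where "K = (LINT x|unit_leb. cmod (v x))"
  have K: "K \<ge> 0" unfolding K_def by simp
  \<comment> \<open>The summand 1 covers the case \<open>K = 0\<close>.\<close>
  define d where "d = e / (K + 1)"
  have d: "d > 0" using e K by (simp add: d_def)
  have "d * K < d * (K + 1)" using d by simp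
  then have dK: "d * K < e" using K by (simp add: d_def)
  have "\<forall>\<^sub>F X in finite_subsets_at_top UNIV. \<forall>x\<in>UNIV. dist (\<Sum>n\<in>X. y n * fmode n x) (fseries y x) < d"
    using fseries_uniform_limit[OF y] d by (simp add: uniform_limit_iff)
  then show "\<forall>\<^sub>F X in finite_subsets_at_top UNIV.
      dist (\<Sum>n\<in>X. y n * cnj (fcoef v n)) (L2_inner (fseries y) v) < e"
  proof eventually_elim
    case (elim X)
    have s: "(\<lambda>x. \<Sum>n\<in>X. y n * fmode n x) \<in> L2" by (intro L2_sum fmode_L2)
    have "(\<Sum>n\<in>X. y n * cnj (fcoef v n)) = L2_inner (\<lambda>x. \<Sum>n\<in>X. y n * fmode n x) v"
      unfolding fcoef_def using v
      by (subst L2_inner_sum_left) (auto intro!: sum.cong fmode_L2 L2_inner_commute[symmetric])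
    then have "(\<Sum>n\<in>X. y n * cnj (fcoef v n)) - L2_inner (fseries y) v
       = L2_inner (\<lambda>x. (\<Sum>n\<in>X. y n * fmode n x) - fseries y x) v"
      using s v fseries_L2[OF y] by (simp add: L2_inner_diff_left)
    moreover have "cmod \<dots> \<le> d * K"
      unfolding K_def using elim
      by (intro L2_inner_bound L2_diff s v fseries_L2[OF y]) (simp add: dist_norm less_imp_le)
    ultimately show ?case using dK by (simp add: dist_norm)
  qed
qed

lemma fcoef_fmode: "fcoef (fmode m) n = (if m = n then 1 else 0)"
  unfolding fcoef_def by (rule L2_inner_fmode)

lemma fcoef_fseries:
  assumes y: "(\<lambda>n. cmod (y n)) summable_on UNIV"
  shows "fcoef (fseries y) k = y k"
proof -
  have "((\<lambda>n. y n * cnj (fcoef (fmode k) n)) has_sum fcoef (fseries y) k) UNIV"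
    unfolding fcoef_def[of "fseries y"] by (rule fseries_inner[OF y fmode_L2])
  moreover have "((\<lambda>n. y n * cnj (fcoef (fmode k) n)) has_sum y k) {k}"
    using has_sum_finite[of "{k}" "\<lambda>n. y n * cnj (fcoef (fmode k) n)"] by (simp add: fcoef_fmode)
  then have "((\<lambda>n. y n * cnj (fcoef (fmode k) n)) has_sum y k) UNIV"
    by (rule has_sum_cong_neutral[THEN iffD1, rotated -1]) (auto simp: fcoef_fmode)
  ultimately show ?thesis by (rule has_sum_unique)
qed

text \<open>Since \<open>y\<close> and its Fourier series share all coefficients, they agree almost
  everywhere. For the eigenfunctions to come, the summability is provided by the factors
  \<open>1 / (lam n - z)\<close>.\<close>

lemma L2_inner_fcoef_has_sum:
  assumes y: "y \<in> L2" "(\<lambda>n. cmod (fcoef y n)) summable_on UNIV" and v: "v \<in> L2"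
  shows "((\<lambda>n. fcoef y n * cnj (fcoef v n)) has_sum L2_inner y v) UNIV"
proof -
  have "AE x in unit_leb. fseries (fcoef y) x = y x"
    by (intro fcoef_eq_imp_AE fseries_L2 fcoef_fseries y)
  then have "L2_inner (fseries (fcoef y)) v = L2_inner y v"
    by (intro L2_inner_cong_AE fseries_L2 y v)
  then show ?thesis using fseries_inner[OF y(2) v] by simp
qed

section \<open>The periodic Sobolev space in Fourier coefficients\<close>

text \<open>Stated with the Henstock-Kurzweil \<open>integral\<close> to gain its calculus on closed
  intervals; \<open>primitive_eq_lebesgue\<close> links it to the integral occurring in
  \<open>W32\<close>.\<close>

definition primitive :: "(real \<Rightarrow> complex) \<Rightarrow> real \<Rightarrow> complex" where
  "primitive f x = integral {0..x} f"

lemma L2_set_integrable: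
  assumes "f \<in> L2" and x: "x \<in> {0..1}"
  shows "set_integrable lebesgue {0<..<x} f"
proof -
  have "set_integrable lebesgue {0<..<1} f"
    using L2_integrable[OF assms(1)] by (simp add: integrable_restrict_space set_integrable_def)
  then show ?thesis by (rule set_integrable_subset) (use x in auto)
qed

lemma primitive_eq_lebesgue:
  assumes "f \<in> L2" "x \<in> {0..1}"
  shows "primitive f x = (LINT t:{0<..<x}|lebesgue. f t)"
  using set_lebesgue_integral_eq_integral(2)[OF L2_set_integrable[OF assms]]
  by (simp add: primitive_def integral_open_interval_real)

lemma L2_absolutely_integrable:
  assumes "f \<in> L2"
  shows "f absolutely_integrable_on {0..1}"
proof -
  have "f absolutely_integrable_on {0<..<1}" using L2_set_integrable[OF assms, of 1] by simp
  then show ?thesis using absolutely_integrable_on_open_interval[where f = f and a = 0 and b = 1] by simp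
qed

lemma L2_integrable_on:
  assumes "f \<in> L2" "x \<in> {0..1}"
  shows "f integrable_on {0..x}"
  using L2_absolutely_integrable[OF assms(1)] assms(2)
  by (intro integrable_on_subinterval[of f "{0..1}" 0 x]) (auto simp: absolutely_integrable_on_def)

lemma primitive_0 [simp]: "primitive f 0 = 0"
  by (simp add: primitive_def)

lemma primitive_1:
  assumes "f \<in> L2"
  shows "primitive f 1 = (LINT x|unit_leb. f x)"
  using primitive_eq_lebesgue[OF assms, of 1]
  by (simp add: integral_restrict_space set_lebesgue_integral_def)

lemma primitive_continuous:
  assumes "f \<in> L2"
  shows "continuous_on {0..1} (primitive f)"
  unfolding primitive_def[abs_def] using L2_integrable_on[OF assms, of 1]
  by (intro indefinite_integral_continuous_1) auto

lemma primitive_deriv: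
  assumes "continuous_on {0..1} f" "x \<in> {0..1}"
  shows "(primitive f has_vector_derivative f x) (at x within {0..1})"
  unfolding primitive_def[abs_def] using assms by (rule integral_has_vector_derivative)

lemma primitive_add:
  assumes "f \<in> L2" "g \<in> L2" "x \<in> {0..1}"
  shows "primitive (\<lambda>x. f x + g x) x = primitive f x + primitive g x"
  unfolding primitive_def using assms by (intro integral_add L2_integrable_on)

lemma norm_primitive_le:
  assumes f: "f \<in> L2" and x: "x \<in> {0..1}"
  shows "cmod (primitive f x) \<le> (LINT x|unit_leb. cmod (f x))"
proof -
  have "(\<lambda>x. cmod (f x)) absolutely_integrable_on {0..1}"
    using L2_absolutely_integrable[OF f] by (rule absolutely_integrable_norm[unfolded o_def])
  then have n: "(\<lambda>x. cmod (f x)) integrable_on {0..1}" by (simp add: absolutely_integrable_on_def)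
  then have nx: "(\<lambda>x. cmod (f x)) integrable_on {0..x}"
    using x by (intro integrable_on_subinterval[of _ "{0..1}" 0 x] n) auto
  have "cmod (primitive f x) \<le> integral {0..x} (\<lambda>x. cmod (f x))"
    unfolding primitive_def using nx L2_integrable_on[OF f x] by (intro integral_norm_bound_integral) auto
  also have "\<dots> \<le> integral {0..1} (\<lambda>x. cmod (f x))"
    using n nx x by (intro integral_subset_le) auto
  also have "\<dots> = integral {0<..<1} (\<lambda>x. cmod (f x))"
    by (simp add: integral_open_interval_real)
  also have "\<dots> = (LINT x|unit_leb. cmod (f x))"
    using L2_integrable[OF f] by (intro lebesgue_integral_eq_integral[symmetric] integrable_norm) auto
  finally show ?thesis .
qed

lemma norm_integral_unit_le:
  assumes f: "f \<in> L2" and B: "\<And>x. x \<in> {0<..<1} \<Longrightarrow> cmod (f x) \<le> B"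
  shows "cmod (LINT x|unit_leb. f x) \<le> B"
  using L2_inner_bound[OF f L2_const[of 1] B] integral_unit_leb_const[of 1]
  by (simp add: L2_inner_def measure_unit_leb_space[simplified])

text \<open>The pointwise inequality \<open>|f| <= e/2 + |f|^2/(2e)\<close>, integrated over an
  interval of length 1, does the work of Cauchy-Schwarz.\<close>

lemma integral_norm_le_of_sq_int:
  assumes f: "f \<in> L2" and e: "e > 0" and lt: "sq_int f \<le> e\<^sup>2"
  shows "(LINT x|unit_leb. cmod (f x)) \<le> e"
proof -
  have "(LINT x|unit_leb. cmod (f x)) \<le> (LINT x|unit_leb. e / 2 + (cmod (f x))\<^sup>2 / (2 * e))"
  proof (rule integral_mono)
    show "integrable unit_leb (\<lambda>x. cmod (f x))" using L2_integrable[OF f] by (rule integrable_norm)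
    show "integrable unit_leb (\<lambda>x. e / 2 + (cmod (f x))\<^sup>2 / (2 * e))"
      using f integrable_unit_leb_const[of "e / 2"] by (auto simp: L2_iff)
    show "cmod (f x) \<le> e / 2 + (cmod (f x))\<^sup>2 / (2 * e)" for x
      using sum_squares_bound[of e "cmod (f x)"] e by (simp add: field_simps power2_eq_square)
  qed
  also have "\<dots> = e / 2 + sq_int f / (2 * e)"
    unfolding sq_int_def using f integrable_unit_leb_const[of "e / 2"] integral_unit_leb_const[of "e / 2"]
    by (subst Bochner_Integration.integral_add) (auto simp: L2_iff)
  also have "\<dots> \<le> e / 2 + e\<^sup>2 / (2 * e)"
    using lt e by (intro add_left_mono divide_right_mono) auto
  also have "\<dots> = e" using e by (simp add: power2_eq_square)
  finally show ?thesis .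
qed

lemma L2_mult_continuous:
  assumes f: "f \<in> L2" and g: "continuous_on {0..1} g"
  shows "(\<lambda>x. f x * g x) \<in> L2"
proof -
  have "compact (g ` {0..1})" using g by (intro compact_continuous_image) auto
  then obtain B where B: "\<And>x. x \<in> {0..1} \<Longrightarrow> cmod (g x) \<le> B"
    using compact_imp_bounded bounded_iff by (metis imageI)
  have m: "(\<lambda>x. f x * g x) \<in> borel_measurable unit_leb"
    using f g by (intro borel_measurable_times L2_measurable continuous_unit_measurable)
  have "integrable unit_leb (\<lambda>x. (cmod (f x * g x))\<^sup>2)"
  proof (rule Bochner_Integration.integrable_bound)
    show "integrable unit_leb (\<lambda>x. B\<^sup>2 * (cmod (f x))\<^sup>2)" using f by (simp add: L2_iff)
    show "AE x in unit_leb. norm ((cmod (f x * g x))\<^sup>2) \<le> norm (B\<^sup>2 * (cmod (f x))\<^sup>2)"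
    proof (rule AE_I2)
      fix x assume "x \<in> space unit_leb"
      then have "(cmod (g x))\<^sup>2 \<le> B\<^sup>2" using B[of x] by (intro power_mono) auto
      then show "norm ((cmod (f x * g x))\<^sup>2) \<le> norm (B\<^sup>2 * (cmod (f x))\<^sup>2)"
        using mult_right_mono[of "(cmod (g x))\<^sup>2" "B\<^sup>2" "(cmod (f x))\<^sup>2"]
        by (simp add: norm_mult power_mult_distrib mult.commute)
    qed
  qed (use m in measurable)
  then show ?thesis using m by (simp add: L2_iff)
qed

text \<open>Both sides are continuous in \<open>f\<close> with respect to the \<open>L\<^sup>1\<close> norm, and for continuous \<open>f\<close>
  the identity is the fundamental theorem of calculus.\<close>

lemma primitive_by_parts:
  assumes f: "f \<in> L2"
    and \<phi>: "\<And>x. x \<in> {0..1} \<Longrightarrow> (\<phi> has_vector_derivative \<phi>' x) (at x within {0..1})"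
    and \<phi>': "continuous_on {0..1} \<phi>'"
  shows "(LINT x|unit_leb. f x * \<phi> x) = primitive f 1 * \<phi> 1 - (LINT x|unit_leb. primitive f x * \<phi>' x)"
proof -
  have \<phi>_cont: "continuous_on {0..1} \<phi>"
    using \<phi> has_vector_derivative_continuous continuous_on_eq_continuous_within by blast
  define D where "D f = (LINT x|unit_leb. f x * \<phi> x) + (LINT x|unit_leb. primitive f x * \<phi>' x) - primitive f 1 * \<phi> 1" for f
  have D_cont: "D g = 0" if g: "continuous_on {0..1} g" for g
  proof -
    have gL: "g \<in> L2" using g by (rule L2_continuous)
    have "(LINT x|unit_leb. g x * \<phi> x + primitive g x * \<phi>' x) = primitive g 1 * \<phi> 1 - primitive g 0 * \<phi> 0"
    proof (rule FTC_unit_leb)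
      fix x :: real assume x: "x \<in> {0..1}"
      show "((\<lambda>x. primitive g x * \<phi> x) has_vector_derivative g x * \<phi> x + primitive g x * \<phi>' x) (at x within {0..1})"
        using has_vector_derivative_mult[OF primitive_deriv[OF g x] \<phi>[OF x]] by (simp add: add.commute)
    qed (intro continuous_intros g \<phi>_cont \<phi>' primitive_continuous gL)
    moreover have "integrable unit_leb (\<lambda>x. g x * \<phi> x)" "integrable unit_leb (\<lambda>x. primitive g x * \<phi>' x)"
      by (intro L2_integrable L2_continuous continuous_intros g \<phi>_cont \<phi>' primitive_continuous gL)+
    ultimately show ?thesis by (simp add: D_def)
  qed
  have "compact (\<phi> ` {0..1})" "compact (\<phi>' ` {0..1})"
    using \<phi>_cont \<phi>' by (auto intro!: compact_continuous_image)
  then obtain K1 K2 where K12: "\<And>x. x \<in> {0..1} \<Longrightarrow> cmod (\<phi> x) \<le> K1" "\<And>x. x \<in> {0..1} \<Longrightarrow> cmod (\<phi>' x) \<le> K2"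
    using compact_imp_bounded bounded_iff by (metis imageI)
  define K where "K = max K1 K2"
  have K: "cmod (\<phi> x) \<le> K" "cmod (\<phi>' x) \<le> K" if "x \<in> {0..1}" for x
    using K12[OF that] by (auto simp: K_def)
  have K0: "K \<ge> 0" using order_trans[OF norm_ge_zero K(1)[of 0]] by simp
  \<comment> \<open>Each of the three terms of \<open>D h\<close> is at most \<open>K\<close> times
    the integral of \<open>|h|\<close>, hence the factor 3.\<close>
  have D_bound: "cmod (D h) \<le> 3 * K * e" if h: "h \<in> L2" and e: "e > 0" "sq_int h \<le> e\<^sup>2" for h e
  proof -
    have I: "(LINT x|unit_leb. cmod (h x)) \<le> e" by (rule integral_norm_le_of_sq_int[OF h e])
    have P: "cmod (primitive h x) \<le> e" if "x \<in> {0..1}" for x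
      using norm_primitive_le[OF h that] I by simp
    have "cmod (L2_inner \<phi> (\<lambda>x. cnj (h x))) \<le> K * (LINT x|unit_leb. cmod (cnj (h x)))"
      using K by (intro L2_inner_bound L2_continuous \<phi>_cont L2_cnj h) auto
    also have "\<dots> \<le> K * e" using I K0 by (intro mult_left_mono) auto
    finally have 1: "cmod (LINT x|unit_leb. h x * \<phi> x) \<le> K * e"
      by (simp add: L2_inner_def mult.commute)
    have 2: "cmod (LINT x|unit_leb. primitive h x * \<phi>' x) \<le> e * K"
    proof (rule norm_integral_unit_le)
      show "cmod (primitive h x * \<phi>' x) \<le> e * K" if "x \<in> {0<..<1}" for x
        unfolding norm_mult using P[of x] K(2)[of x] that e by (intro mult_mono) auto
    qed (intro L2_continuous continuous_intros primitive_continuous h \<phi>')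
    have 3: "cmod (primitive h 1 * \<phi> 1) \<le> e * K"
      unfolding norm_mult using P[of 1] K(1)[of 1] e by (intro mult_mono) auto
    have "cmod (D h) \<le> cmod (LINT x|unit_leb. h x * \<phi> x) + cmod (LINT x|unit_leb. primitive h x * \<phi>' x)
        + cmod (primitive h 1 * \<phi> 1)"
      unfolding D_def
      by (rule order_trans[OF norm_triangle_ineq4 add_right_mono[OF norm_triangle_ineq]])
    also have "\<dots> \<le> K * e + e * K + e * K" by (intro add_mono 1 2 3)
    finally show ?thesis by simp
  qed
  have D_add: "D (\<lambda>x. g x + h x) = D g + D h" if g: "g \<in> L2" and h: "h \<in> L2" for g h
  proof -
    have "(LINT x|unit_leb. (g x + h x) * \<phi> x) = (LINT x|unit_leb. g x * \<phi> x) + (LINT x|unit_leb. h x * \<phi> x)"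
      unfolding distrib_right
      by (intro Bochner_Integration.integral_add L2_integrable L2_mult_continuous g h \<phi>_cont)
    moreover have "(LINT x|unit_leb. primitive (\<lambda>x. g x + h x) x * \<phi>' x)
       = (LINT x|unit_leb. primitive g x * \<phi>' x + primitive h x * \<phi>' x)"
      using primitive_add[OF g h] by (intro Bochner_Integration.integral_cong) (auto simp: distrib_right)
    moreover have "\<dots> = (LINT x|unit_leb. primitive g x * \<phi>' x) + (LINT x|unit_leb. primitive h x * \<phi>' x)"
      by (intro Bochner_Integration.integral_add L2_integrable L2_mult_continuous L2_continuous
          primitive_continuous g h \<phi>')
    ultimately show ?thesis using primitive_add[OF g h, of 1] by (simp add: D_def algebra_simps)
  qed
  have "cmod (D f) \<le> 0 + d" if d: "d > 0" for d
  proof -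
    define e where "e = d / (3 * K + 1)"
    have e: "e > 0" using d K0 by (simp add: e_def)
    obtain g where g: "continuous_on UNIV g" "sq_int (\<lambda>x. f x - g x) < e\<^sup>2"
      using L2_approx_continuous[OF f, of "e\<^sup>2"] e by auto
    have gc: "continuous_on {0..1} g" using g(1) by (rule continuous_on_subset) auto
    have gL: "g \<in> L2" using gc by (rule L2_continuous)
    have "D f = D (\<lambda>x. g x + (f x - g x))" by simp
    also have "\<dots> = D g + D (\<lambda>x. f x - g x)" by (intro D_add gL L2_diff f)
    finally have "cmod (D f) \<le> 3 * K * e"
      using D_bound[OF L2_diff[OF f gL] e] g(2) D_cont[OF gc] by simp
    also have "\<dots> \<le> (3 * K + 1) * e" using e by (simp add: distrib_right)
    also have "\<dots> = d" using K0 by (simp add: e_def)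
    finally show ?thesis by simp
  qed
  then have "cmod (D f) \<le> 0" by (rule field_le_epsilon)
  then show ?thesis by (simp add: D_def algebra_simps)
qed

lemma fcoef_eq: "fcoef f n = (LINT x|unit_leb. f x * fmode (- n) x)"
  by (simp add: fcoef_def L2_inner_def cnj_fmode)

text \<open>Integration by parts against \<open>fmode (- n)\<close>, with a boundary term that
  vanishes by periodicity. The additive constant \<open>u 0\<close> is orthogonal to every mode
  except \<open>n = 0\<close>, where the factor in front is 0.\<close>

lemma fcoef_primitive:
  assumes f: "f \<in> L2" and u: "\<And>x. x \<in> {0..1} \<Longrightarrow> primitive f x = u x - u 0" and per: "u 1 = u 0"
  shows "fcoef f n = (2 * pi * \<i> * of_int n) * fcoef u n"
proof -
  define c where "c = 2 * pi * \<i> * of_int n"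
  have c': "2 * pi * \<i> * of_int (- n) = - c" by (simp add: c_def)
  have p1: "primitive f 1 = 0" using u[of 1] per by simp
  have "fcoef f n = primitive f 1 * fmode (- n) 1 - (LINT x|unit_leb. primitive f x * (- c * fmode (- n) x))"
    unfolding fcoef_eq
    by (rule primitive_by_parts[OF f]) 
       (use fmode_deriv[of "-n"] c' in \<open>auto intro!: continuous_intros fmode_continuous\<close>)
  also have "\<dots> = c * fcoef (primitive f) n"
    by (simp add: p1 fcoef_eq mult.left_commute[of _ c])
  also have "fcoef (primitive f) n = (LINT x|unit_leb. u x * fmode (- n) x + (- u 0) * fmode (- n) x)"
    unfolding fcoef_eq by (intro Bochner_Integration.integral_cong) (auto simp: u left_diff_distrib)
  also have "\<dots> = fcoef u n + (- u 0) * (LINT x|unit_leb. fmode (- n) x)"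
  proof -
    have "continuous_on {0..1} (\<lambda>x. u 0 + primitive f x)"
      by (intro continuous_intros primitive_continuous f)
    then have "continuous_on {0..1} u"
      by (rule continuous_on_eq) (simp add: u)
    then have "integrable unit_leb (\<lambda>x. u x * fmode (- n) x)"
      by (intro L2_integrable L2_continuous continuous_intros fmode_continuous)
    then show ?thesis using L2_integrable[OF fmode_L2[of "-n"]] by (simp add: fcoef_eq)
  qed
  also have "c * \<dots> = c * fcoef u n"
    by (simp add: integral_fmode c_def)
  finally show ?thesis unfolding c_def .
qed

lemma vector_derivative_primitive:
  assumes d: "\<And>x. x \<in> {0..1} \<Longrightarrow> (u has_vector_derivative u' x) (at x within {0..1})" and x: "x \<in> {0..1}"
  shows "primitive u' x = u x - u 0"
proof -
  have "(u' has_integral u x - u 0) {0..x}"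
    using x by (intro fundamental_theorem_of_calculus has_vector_derivative_within_subset[OF d]) auto
  then show ?thesis by (simp add: primitive_def integral_unique)
qed

text \<open>Each derivative brings out a factor \<open>2 * pi * i * n\<close>, and
  \<open>i * (2 * pi * i * n)^3 = lam n\<close>.\<close>

lemma periodic_W32_fcoef:
  assumes "periodic_W32 u0 u1 u2 u3"
  shows "\<i> * fcoef u3 n = of_real (lam n) * fcoef u0 n"
proof -
  have W: "\<And>x. x \<in> {0..1} \<Longrightarrow> (u0 has_vector_derivative u1 x) (at x within {0..1})"
    "\<And>x. x \<in> {0..1} \<Longrightarrow> (u1 has_vector_derivative u2 x) (at x within {0..1})"
    "u3 \<in> L2" "\<And>x. x \<in> {0..1} \<Longrightarrow> u2 x = u2 0 + (LINT t:{0<..<x}|lebesgue. u3 t)"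
    and per: "u0 1 = u0 0" "u1 1 = u1 0" "u2 1 = u2 0"
    using assms unfolding periodic_W32_def W32_def by blast+
  have u2: "primitive u3 x = u2 x - u2 0" if "x \<in> {0..1}" for x
    unfolding primitive_eq_lebesgue[OF W(3) that] by (subst W(4)[OF that]) simp
  have "continuous_on {0..1} (\<lambda>x. u2 0 + primitive u3 x)"
    by (intro continuous_intros primitive_continuous W(3))
  then have "continuous_on {0..1} u2"
    by (rule continuous_on_eq) (simp add: u2)
  then have u2L: "u2 \<in> L2" by (rule L2_continuous)
  have "continuous_on {0..1} u1"
    using W(2) has_vector_derivative_continuous continuous_on_eq_continuous_within by blast
  then have u1L: "u1 \<in> L2" by (rule L2_continuous)
  have "fcoef u3 n = (2 * pi * \<i> * of_int n) * ((2 * pi * \<i> * of_int n) * ((2 * pi * \<i> * of_int n) * fcoef u0 n))"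
    using fcoef_primitive[OF W(3) u2 per(3), of n]
      fcoef_primitive[OF u2L vector_derivative_primitive[OF W(2)] per(2), of n]
      fcoef_primitive[OF u1L vector_derivative_primitive[OF W(1)] per(1), of n] by simp
  then show ?thesis by (simp add: lam_def power3_eq_cube algebra_simps)
qed

text \<open>Zero mean makes the primitive periodic, and the constant of integration adjusts its mean
  to \<open>c\<close>.\<close>

lemma periodic_primitive_exists:
  assumes f: "f \<in> L2" and mean: "fcoef f 0 = 0"
  shows "\<exists>u. continuous_on {0..1} u \<and> (\<forall>x\<in>{0..1}. primitive f x = u x - u 0) \<and> u 1 = u 0 \<and> fcoef u 0 = c"
proof -
  define k where "k = c - fcoef (primitive f) 0"
  define u where "u x = k + primitive f x" for x
  have "primitive f 1 = 0" using mean primitive_1[OF f] by (simp add: fcoef_eq)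
  moreover have "fcoef u 0 = k + fcoef (primitive f) 0"
  proof -
    have "fcoef u 0 = fcoef (\<lambda>x. k * fmode 0 x) 0 + fcoef (primitive f) 0"
      unfolding u_def
      using fcoef_add[OF L2_scale[OF fmode_L2] L2_continuous[OF primitive_continuous[OF f]], of k 0 0] by simp
    then show ?thesis by (simp only: fcoef_scale fcoef_fmode) simp
  qed
  ultimately show ?thesis
    by (intro exI[of _ u]) (auto simp: u_def k_def intro!: continuous_intros primitive_continuous f)
qed

text \<open>The function \<open>- i r\<close> is integrated three times. \<open>u2\<close> and
  \<open>u1\<close> receive mean 0 so that the next primitive is periodic. The relation at
  \<open>n = 0\<close> says that \<open>r\<close> has mean 0 and leaves \<open>y 0\<close> free, so
  the last constant of integration sets it.\<close>

lemma periodic_W32_exists: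
  assumes r: "r \<in> L2" and y: "\<And>n. of_real (lam n) * y n = fcoef r n"
  shows "\<exists>u0 u1 u2. periodic_W32 u0 u1 u2 (\<lambda>x. - \<i> * r x) \<and> continuous_on {0..1} u0 \<and> (\<forall>n. fcoef u0 n = y n)"
proof -
  define u3 where "u3 x = - \<i> * r x" for x
  have u3L: "u3 \<in> L2" unfolding u3_def using r by (rule L2_scale)
  have u3c: "fcoef u3 n = - \<i> * fcoef r n" for n unfolding u3_def by (rule fcoef_scale)
  have "fcoef u3 0 = 0" using u3c[of 0] y[of 0] by simp
  then obtain u2 where u2: "continuous_on {0..1} u2" "\<And>x. x \<in> {0..1} \<Longrightarrow> primitive u3 x = u2 x - u2 0"
    "u2 1 = u2 0" "fcoef u2 0 = 0"
    using periodic_primitive_exists[OF u3L, of 0] by blast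
  obtain u1 where u1: "continuous_on {0..1} u1" "\<And>x. x \<in> {0..1} \<Longrightarrow> primitive u2 x = u1 x - u1 0"
    "u1 1 = u1 0" "fcoef u1 0 = 0"
    using periodic_primitive_exists[OF L2_continuous[OF u2(1)] u2(4), of 0] by blast
  obtain u0 where u0: "continuous_on {0..1} u0" "\<And>x. x \<in> {0..1} \<Longrightarrow> primitive u1 x = u0 x - u0 0"
    "u0 1 = u0 0" "fcoef u0 0 = y 0"
    using periodic_primitive_exists[OF L2_continuous[OF u1(1)] u1(4), of "y 0"] by blast
  have deriv: "(u has_vector_derivative u' x) (at x within {0..1})"
    if "continuous_on {0..1} u'" "\<And>x. x \<in> {0..1} \<Longrightarrow> primitive u' x = u x - u 0" "x \<in> {0..1}" for u u' x
  proof -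
    have "((\<lambda>x. u 0 + primitive u' x) has_vector_derivative 0 + u' x) (at x within {0..1})"
      by (intro has_vector_derivative_add has_vector_derivative_const primitive_deriv that)
    then have "((\<lambda>x. u 0 + primitive u' x) has_vector_derivative u' x) (at x within {0..1})" by simp
    then show ?thesis
      by (rule has_vector_derivative_transform[OF that(3), rotated]) (simp add: that(2))
  qed
  have W: "periodic_W32 u0 u1 u2 u3"
    unfolding periodic_W32_def W32_def
  proof (intro conjI ballI)
    fix x :: real assume x: "x \<in> {0..1}"
    show "(u0 has_vector_derivative u1 x) (at x within {0..1})" by (rule deriv[OF u1(1) u0(2) x])
    show "(u1 has_vector_derivative u2 x) (at x within {0..1})" by (rule deriv[OF u2(1) u1(2) x])
    show "u2 x = u2 0 + (LINT t:{0<..<x}|lebesgue. u3 t)"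
      unfolding primitive_eq_lebesgue[OF u3L x, symmetric] using u2(2)[OF x] by simp
  qed (use u0 u1 u2 u3L in auto)
  have "fcoef u0 n = y n" for n
  proof (cases "n = 0")
    case True
    then show ?thesis using u0(4) by simp
  next
    case False
    have "of_real (lam n) * fcoef u0 n = of_real (lam n) * y n"
      using periodic_W32_fcoef[OF W, of n] u3c[of n] y[of n] by auto
    moreover have "lam n \<noteq> 0" using False lam_eq_iff[of n 0] by simp
    ultimately show ?thesis by simp
  qed
  then show ?thesis using W u0(1) unfolding u3_def[abs_def] by blast
qed

section \<open>Eigenspaces of the perturbed operator\<close>

lemma fcoef_zero_iff:
  assumes "f \<in> L2"
  shows "(AE x in unit_leb. f x = 0) \<longleftrightarrow> (\<forall>n. fcoef f n = 0)"
proof -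
  have z: "fcoef (\<lambda>x. 0) n = 0" for n by (simp add: fcoef_def L2_inner_def)
  show ?thesis
    using fcoef_cong_AE[OF assms L2_const[of 0]] fcoef_eq_imp_AE[OF assms L2_const[of 0]] z by auto
qed

text \<open>The domain condition is absorbed: the relation says that
  \<open>r = z y - \<alpha> <y,v> v\<close> has the coefficients \<open>lam n * fcoef y n\<close>,
  and integrating \<open>r\<close> three times produces a periodic Sobolev function that equals
  \<open>y\<close> almost everywhere.\<close>

lemma eigenspace_nonlocal_iff:
  assumes v: "v \<in> L2"
  shows "y \<in> eigenspace (L_nonlocal \<alpha> v) z \<longleftrightarrow>
    y \<in> L2 \<and> (\<forall>n. (of_real (lam n) - z) * fcoef y n = - of_real \<alpha> * L2_inner y v * fcoef v n)"
    (is "_ \<longleftrightarrow> y \<in> L2 \<and> ?rel")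
proof
  assume "y \<in> eigenspace (L_nonlocal \<alpha> v) z"
  then obtain h u0 u1 u2 u3 where y: "y \<in> L2" and h: "h \<in> L2" and W: "periodic_W32 u0 u1 u2 u3"
    and yu: "AE x in unit_leb. y x = u0 x"
    and hu: "AE x in unit_leb. h x = \<i> * u3 x + of_real \<alpha> * L2_inner y v * v x"
    and hz: "AE x in unit_leb. h x = z * y x"
    by (auto simp: eigenspace_def L_nonlocal_def)
  have u3: "u3 \<in> L2" using W by (simp add: periodic_W32_def W32_def)
  have "\<And>x. x \<in> {0..1} \<Longrightarrow> (u0 has_vector_derivative u1 x) (at x within {0..1})"
    using W by (simp add: periodic_W32_def W32_def)
  then have "continuous_on {0..1} u0"
    using has_vector_derivative_continuous continuous_on_eq_continuous_within by blast
  then have u0: "u0 \<in> L2" by (rule L2_continuous)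
  have ?rel
  proof
    fix n
    have "fcoef y n = fcoef u0 n" by (intro fcoef_cong_AE y u0 yu)
    moreover have "fcoef h n = fcoef (\<lambda>x. z * y x) n" by (intro fcoef_cong_AE h L2_scale y hz)
    moreover have "fcoef h n = fcoef (\<lambda>x. \<i> * u3 x + of_real \<alpha> * L2_inner y v * v x) n"
      by (intro fcoef_cong_AE h L2_add L2_scale u3 v hu)
    moreover have "\<dots> = \<i> * fcoef u3 n + of_real \<alpha> * L2_inner y v * fcoef v n"
      by (subst fcoef_add) (auto intro: L2_scale u3 v simp: fcoef_scale)
    ultimately show "(of_real (lam n) - z) * fcoef y n = - of_real \<alpha> * L2_inner y v * fcoef v n"
      using periodic_W32_fcoef[OF W, of n] by (simp add: fcoef_scale algebra_simps)
  qed
  then show "y \<in> L2 \<and> ?rel" using y by simp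
next
  assume yr: "y \<in> L2 \<and> ?rel"
  then have y: "y \<in> L2" by simp
  define r where "r x = z * y x - of_real \<alpha> * L2_inner y v * v x" for x
  have r: "r \<in> L2" unfolding r_def by (intro L2_diff L2_scale y v)
  have "of_real (lam n) * fcoef y n = fcoef r n" for n
  proof -
    have "(of_real (lam n) - z) * fcoef y n = - of_real \<alpha> * L2_inner y v * fcoef v n"
      using yr by blast
    moreover have "fcoef r n = z * fcoef y n - of_real \<alpha> * L2_inner y v * fcoef v n"
      unfolding r_def by (subst fcoef_diff) (auto intro: L2_scale y v simp: fcoef_scale)
    moreover have "of_real (lam n) * fcoef y n = (of_real (lam n) - z) * fcoef y n + z * fcoef y n"
      by (simp add: algebra_simps)
    ultimately show ?thesis by simp
  qed
  then obtain u0 u1 u2 where u: "periodic_W32 u0 u1 u2 (\<lambda>x. - \<i> * r x)" "continuous_on {0..1} u0"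
      "\<And>n. fcoef u0 n = fcoef y n"
    using periodic_W32_exists[OF r] by blast
  have "AE x in unit_leb. y x = u0 x"
    by (intro fcoef_eq_imp_AE y L2_continuous u) (simp add: u)
  moreover have "AE x in unit_leb. z * y x = \<i> * (- \<i> * r x) + of_real \<alpha> * L2_inner y v * v x"
    by (simp add: r_def)
  ultimately have "(y, \<lambda>x. z * y x) \<in> L_nonlocal \<alpha> v"
    unfolding L_nonlocal_def using y L2_scale[OF y, of z] u(1) by blast
  then show "y \<in> eigenspace (L_nonlocal \<alpha> v) z"
    by (auto simp: eigenspace_def)
qed

lemma eigenspace_nonlocal_L2:
  assumes "y \<in> eigenspace (L_nonlocal \<alpha> v) z"
  shows "y \<in> L2"
  using assms by (auto simp: eigenspace_def L_nonlocal_def)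

lemma eigenspace_nonlocal_lincomb:
  assumes v: "v \<in> L2" and y: "y \<in> eigenspace (L_nonlocal \<alpha> v) z" and w: "w \<in> eigenspace (L_nonlocal \<alpha> v) z"
  shows "(\<lambda>x. a * y x + b * w x) \<in> eigenspace (L_nonlocal \<alpha> v) z"
proof -
  note Y = y[unfolded eigenspace_nonlocal_iff[OF v]] and W = w[unfolded eigenspace_nonlocal_iff[OF v]]
  have L: "y \<in> L2" "w \<in> L2" using Y W by auto
  have i: "L2_inner (\<lambda>x. a * y x + b * w x) v = a * L2_inner y v + b * L2_inner w v"
    by (subst L2_inner_add_left) (auto intro: L2_scale L v simp: L2_inner_scale_left)
  have c: "fcoef (\<lambda>x. a * y x + b * w x) n = a * fcoef y n + b * fcoef w n" for n
    by (subst fcoef_add) (auto intro: L2_scale L simp: fcoef_scale)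
  have "(of_real (lam n) - z) * fcoef (\<lambda>x. a * y x + b * w x) n
     = - of_real \<alpha> * L2_inner (\<lambda>x. a * y x + b * w x) v * fcoef v n" for n
  proof -
    have "(of_real (lam n) - z) * fcoef (\<lambda>x. a * y x + b * w x) n
      = a * ((of_real (lam n) - z) * fcoef y n) + b * ((of_real (lam n) - z) * fcoef w n)"
      unfolding c by (simp add: algebra_simps)
    also have "(of_real (lam n) - z) * fcoef y n = - of_real \<alpha> * L2_inner y v * fcoef v n" using Y by blast
    also have "(of_real (lam n) - z) * fcoef w n = - of_real \<alpha> * L2_inner w v * fcoef v n" using W by blast
    finally show ?thesis unfolding i by (simp add: algebra_simps)
  qed
  then show ?thesis unfolding eigenspace_nonlocal_iff[OF v] by (intro conjI allI L2_add L2_scale L)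
qed

lemma fmode_eigenfunction:
  assumes v: "v \<in> L2" and "of_real \<alpha> * fcoef v k = 0"
  shows "fmode k \<in> eigenspace (L_nonlocal \<alpha> v) (of_real (lam k))"
proof -
  have "\<alpha> = 0 \<or> L2_inner (fmode k) v = 0"
    using assms(2) L2_inner_commute[of "fmode k" v] by (auto simp: fcoef_def)
  then show ?thesis
    by (auto simp: eigenspace_nonlocal_iff[OF v] fcoef_fmode fmode_L2)
qed

text \<open>The eigenvalue relation forces the coefficients
  \<open>- \<alpha> * c * v_n / (lam n - z)\<close> with \<open>c = <y,v>\<close>; inserting them
  into \<open><y,v>\<close> gives \<open>c * F(z) = 0\<close>. If \<open>z = lam n\<close>, the mode
  \<open>fmode n\<close> is an eigenfunction in any case, and the condition
  \<open>fcoef y n = 0\<close> discounts it.\<close>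

lemma char_fun_zero_iff:
  assumes v: "v \<in> L2" and b: "\<And>n. b n = \<alpha> * (cmod (fcoef v n))\<^sup>2"
    and z: "\<And>n. of_real (lam n) = z \<Longrightarrow> b n = 0"
  shows "char_fun b z = 0 \<longleftrightarrow> (\<exists>y\<in>eigenspace (L_nonlocal \<alpha> v) z.
     \<not> (AE x in unit_leb. y x = 0) \<and> (\<forall>n. of_real (lam n) = z \<longrightarrow> fcoef y n = 0))"
proof -
  define M where "M = sqrt (sq_int v)"
  have M: "cmod (fcoef v n) \<le> M" for n unfolding M_def by (rule norm_fcoef_le[OF v])
  show ?thesis
  proof
    assume zero: "char_fun b z = 0"
    then have \<alpha>: "\<alpha> \<noteq> 0" using b by (auto simp: char_fun_def pole_sum_def)
    \<comment> \<open>The scaling is such that \<open>- \<alpha> * <y,v> = 1\<close>; where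
      \<open>lam n = z\<close>, division by zero makes \<open>y n\<close> vanish.\<close>
    define y where "y n = fcoef v n / (of_real (lam n) - z)" for n
    have y: "(\<lambda>n. cmod (y n)) summable_on UNIV"
      unfolding y_def by (rule pole_sum_abs_summable[OF M])
    have "L2_inner (fseries y) v = (\<Sum>\<^sub>\<infinity>n. y n * cnj (fcoef v n))"
      using fseries_inner[OF y v] by (rule infsumI[symmetric])
    also have "\<dots> = (\<Sum>\<^sub>\<infinity>n. of_real (1 / \<alpha>) * (of_real (b n) / (of_real (lam n) - z)))"
    proof (rule infsum_cong)
      fix n
      have "fcoef v n * cnj (fcoef v n) = of_real (1 / \<alpha> * b n)"
        using \<alpha> by (simp add: b complex_norm_square[symmetric] del: of_real_power)
      then show "y n * cnj (fcoef v n) = of_real (1 / \<alpha>) * (of_real (b n) / (of_real (lam n) - z))"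
        by (simp add: y_def)
    qed
    also have "\<dots> = of_real (1 / \<alpha>) * pole_sum (\<lambda>n. of_real (b n)) z"
      unfolding pole_sum_def by (rule infsum_cmult_right')
    also have "pole_sum (\<lambda>n. of_real (b n)) z = -1"
      using zero by (simp add: char_fun_def add_eq_0_iff)
    finally have c: "L2_inner (fseries y) v = - of_real (1 / \<alpha>)" by simp
    have fc: "fcoef (fseries y) n = y n" for n by (rule fcoef_fseries[OF y])
    have zc: "fcoef v n = 0" if "of_real (lam n) = z" for n
      using z[OF that] \<alpha> by (simp add: b)
    have "fseries y \<in> eigenspace (L_nonlocal \<alpha> v) z"
      unfolding eigenspace_nonlocal_iff[OF v] fc c
    proof (intro conjI allI fseries_L2[OF y])
      fix n show "(of_real (lam n) - z) * y n = - of_real \<alpha> * - of_real (1 / \<alpha>) * fcoef v n"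
        using \<alpha> zc[of n] by (cases "of_real (lam n) = z") (auto simp: y_def)
    qed
    moreover have "\<not> (AE x in unit_leb. fseries y x = 0)"
    proof
      assume "AE x in unit_leb. fseries y x = 0"
      then have "L2_inner (fseries y) v = L2_inner (\<lambda>x. 0) v"
        by (intro L2_inner_cong_AE fseries_L2[OF y] v L2_const) auto
      then show False using c \<alpha> by (simp add: L2_inner_def)
    qed
    moreover have "\<forall>n. of_real (lam n) = z \<longrightarrow> fcoef (fseries y) n = 0"
      unfolding fc by (simp add: y_def)
    ultimately show "\<exists>y\<in>eigenspace (L_nonlocal \<alpha> v) z.
       \<not> (AE x in unit_leb. y x = 0) \<and> (\<forall>n. of_real (lam n) = z \<longrightarrow> fcoef y n = 0)" by blast
  next
    assume "\<exists>y\<in>eigenspace (L_nonlocal \<alpha> v) z.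
       \<not> (AE x in unit_leb. y x = 0) \<and> (\<forall>n. of_real (lam n) = z \<longrightarrow> fcoef y n = 0)"
    then obtain y where E: "y \<in> eigenspace (L_nonlocal \<alpha> v) z"
       and nz: "\<not> (AE x in unit_leb. y x = 0)" and yz: "\<And>n. of_real (lam n) = z \<Longrightarrow> fcoef y n = 0"
      by blast
    have y: "y \<in> L2"
       and rel: "\<And>n. (of_real (lam n) - z) * fcoef y n = - of_real \<alpha> * L2_inner y v * fcoef v n"
      using E unfolding eigenspace_nonlocal_iff[OF v] by auto
    define c where "c = L2_inner y v"
    define s where "s = - of_real \<alpha> * c"
    have yn: "fcoef y n = s * (fcoef v n / (of_real (lam n) - z))" for n
    proof (cases "of_real (lam n) = z")
      case True
      then show ?thesis using yz by simp
    next
      case False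
      then show ?thesis using rel[of n] by (simp add: s_def c_def field_simps)
    qed
    have "(\<lambda>n. cmod (fcoef y n)) summable_on UNIV"
      unfolding yn norm_mult by (intro summable_on_cmult_right pole_sum_abs_summable[OF M])
    then have "((\<lambda>n. fcoef y n * cnj (fcoef v n)) has_sum c) UNIV"
      unfolding c_def by (intro L2_inner_fcoef_has_sum y v)
    then have "c = (\<Sum>\<^sub>\<infinity>n. fcoef y n * cnj (fcoef v n))" by (rule infsumI[symmetric])
    also have "\<dots> = (\<Sum>\<^sub>\<infinity>n. - c * (of_real (b n) / (of_real (lam n) - z)))"
    proof (rule infsum_cong)
      fix n
      have ab: "of_real (b n) = of_real \<alpha> * (fcoef v n * cnj (fcoef v n))"
        by (simp add: b complex_norm_square[symmetric] del: of_real_power)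
      then show "fcoef y n * cnj (fcoef v n) = - c * (of_real (b n) / (of_real (lam n) - z))"
        unfolding yn s_def ab by simp
    qed
    also have "\<dots> = - c * pole_sum (\<lambda>n. of_real (b n)) z"
      unfolding pole_sum_def by (rule infsum_cmult_right')
    finally have "c * char_fun b z = 0"
      by (simp only: char_fun_def distrib_left mult_1_right mult_minus_left eq_neg_iff_add_eq_0)
    moreover have "c \<noteq> 0"
    proof
      assume "c = 0"
      then have "fcoef y n = 0" for n by (simp add: yn s_def)
      then show False using nz fcoef_zero_iff[OF y] by blast
    qed
    ultimately show "char_fun b z = 0" by simp
  qed
qed

section \<open>From spectra with multiplicities to the weights\<close>

definition has_independent :: "L2_operator \<Rightarrow> complex \<Rightarrow> nat \<Rightarrow> bool" where
  "has_independent T z n \<longleftrightarrow> (\<exists>u. (\<forall>i<n. u i \<in> eigenspace T z) \<and> L2_independent n u)"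

lemma L2_independent_mono:
  assumes u: "L2_independent m u" and "n \<le> m"
  shows "L2_independent n u"
  unfolding L2_independent_def
proof (rule allI, rule impI)
  fix c :: "nat \<Rightarrow> complex" assume c: "AE x in unit_leb. (\<Sum>i<n. c i * u i x) = 0"
  define d where "d i = (if i < n then c i else 0)" for i
  have "(\<Sum>i<m. d i * u i x) = (\<Sum>i<n. c i * u i x)" for x
    using \<open>n \<le> m\<close> by (intro sum.mono_neutral_cong_right) (auto simp: d_def)
  then have "AE x in unit_leb. (\<Sum>i<m. d i * u i x) = 0" using c by simp
  then have "\<forall>i<m. d i = 0" using u by (simp add: L2_independent_def)
  then show "\<forall>i<n. c i = 0" using \<open>n \<le> m\<close> by (auto simp: d_def split: if_splits)
qed

text \<open>Initial segments of independent families are independent, so if size \<open>n\<close>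
  fails, every possible size is at most \<open>n - 1\<close>. Comparing with thresholds treats
  finite and infinite multiplicities alike.\<close>

lemma le_multiplicity_at_iff: "enat n \<le> multiplicity_at T z \<longleftrightarrow> has_independent T z n"
proof
  assume "has_independent T z n"
  then show "enat n \<le> multiplicity_at T z"
    unfolding multiplicity_at_def has_independent_def by (intro Sup_upper) auto
next
  assume le: "enat n \<le> multiplicity_at T z"
  show "has_independent T z n"
  proof (rule ccontr)
    assume no: "\<not> has_independent T z n"
    then have "n \<noteq> 0" by (auto simp: has_independent_def L2_independent_def)
    have "m < n" if "has_independent T z m" for m
    proof (rule ccontr)
      assume "\<not> m < n"
      then show False using that no L2_independent_mono[of m _ n]
        unfolding has_independent_def by (meson leI less_le_trans)
    qed
    then have le_pred: "m \<le> n - 1" if "has_independent T z m" for m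
      using that \<open>n \<noteq> 0\<close> by fastforce
    have "multiplicity_at T z \<le> enat (n - 1)"
      unfolding multiplicity_at_def has_independent_def[symmetric]
    proof (rule Sup_least)
      fix x assume "x \<in> {enat m |m. has_independent T z m}"
      then obtain m where "x = enat m" "has_independent T z m" by blast
      then show "x \<le> enat (n - 1)" using le_pred by simp
    qed
    then have "enat n \<le> enat (n - 1)" using le by (rule order_trans[rotated])
    then show False using \<open>n \<noteq> 0\<close> by simp
  qed
qed

lemma has_independent_1:
  "has_independent T z 1 \<longleftrightarrow> (\<exists>y\<in>eigenspace T z. \<not> (AE x in unit_leb. y x = 0))"
proof
  assume "has_independent T z 1"
  then obtain u where u: "u 0 \<in> eigenspace T z" "L2_independent 1 u"
    by (auto simp: has_independent_def)
  then show "\<exists>y\<in>eigenspace T z. \<not> (AE x in unit_leb. y x = 0)"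
    by (intro bexI[of _ "u 0"]) (auto simp: L2_independent_def dest: spec[of _ "\<lambda>_. 1"])
next
  assume "\<exists>y\<in>eigenspace T z. \<not> (AE x in unit_leb. y x = 0)"
  then obtain y where y: "y \<in> eigenspace T z" "\<not> (AE x in unit_leb. y x = 0)" by blast
  have "L2_independent 1 (\<lambda>_. y)"
    unfolding L2_independent_def
  proof (rule allI, rule impI)
    fix c :: "nat \<Rightarrow> complex" assume "AE x in unit_leb. (\<Sum>i<1. c i * y x) = 0"
    then have "AE x in unit_leb. c 0 = 0 \<or> y x = 0" by simp
    then show "\<forall>i<1. c i = 0" using y(2) by (cases "c 0 = 0") auto
  qed
  then show "has_independent T z 1"
    unfolding has_independent_def using y(1) by (intro exI[of _ "\<lambda>_. y"]) simp
qed

lemma has_independent_2: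
  "has_independent T z 2 \<longleftrightarrow> (\<exists>y\<in>eigenspace T z. \<exists>w\<in>eigenspace T z.
     \<forall>a b. (AE x in unit_leb. a * y x + b * w x = 0) \<longrightarrow> a = 0 \<and> b = 0)"
proof
  assume "has_independent T z 2"
  then obtain u where "\<forall>i<2. u i \<in> eigenspace T z" and ind: "L2_independent 2 u"
    unfolding has_independent_def by blast
  then have u: "u 0 \<in> eigenspace T z" "u 1 \<in> eigenspace T z" by auto
  have "a = 0 \<and> b = 0" if "AE x in unit_leb. a * u 0 x + b * u 1 x = 0" for a b
  proof -
    have "(AE x in unit_leb. (\<Sum>i<2. (if i = 0 then a else b) * u i x) = 0) \<longrightarrow>
       (\<forall>i<2::nat. (if i = 0 then a else b) = 0)"
      using ind unfolding L2_independent_def by (rule spec)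
    then have "\<forall>i<2::nat. (if i = 0 then a else b) = 0"
      using that by (simp add: numeral_2_eq_2)
    from spec[OF this, of 0] spec[OF this, of 1] show ?thesis by simp
  qed
  then show "\<exists>y\<in>eigenspace T z. \<exists>w\<in>eigenspace T z.
     \<forall>a b. (AE x in unit_leb. a * y x + b * w x = 0) \<longrightarrow> a = 0 \<and> b = 0"
    using u by blast
next
  assume "\<exists>y\<in>eigenspace T z. \<exists>w\<in>eigenspace T z.
     \<forall>a b. (AE x in unit_leb. a * y x + b * w x = 0) \<longrightarrow> a = 0 \<and> b = 0"
  then obtain y w where yw: "y \<in> eigenspace T z" "w \<in> eigenspace T z"
    "\<And>a b. (AE x in unit_leb. a * y x + b * w x = 0) \<Longrightarrow> a = 0 \<and> b = 0" by blast
  define u where "u i = (if i = 0 then y else w)" for i :: nat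
  have "L2_independent 2 u"
    unfolding L2_independent_def
  proof (rule allI, rule impI)
    fix c :: "nat \<Rightarrow> complex" assume "AE x in unit_leb. (\<Sum>i<2. c i * u i x) = 0"
    then have "c 0 = 0 \<and> c 1 = 0" by (intro yw(3)) (simp add: numeral_2_eq_2 u_def)
    then show "\<forall>i<2. c i = 0" by (simp add: numeral_2_eq_2 less_Suc_eq)
  qed
  then show "has_independent T z 2"
    unfolding has_independent_def using yw(1,2) by (intro exI[of _ u]) (auto simp: u_def)
qed

text \<open>Outside the spectrum the lower bound for \<open>T - z\<close> forces trivial eigenspaces, so the spectrum
  with multiplicities records the multiplicity at every complex number.\<close>

lemma resolvent_no_eigenfunction:
  assumes z: "z \<notin> spectrum (L_nonlocal \<alpha> v)" and y: "y \<in> eigenspace (L_nonlocal \<alpha> v) z"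
  shows "AE x in unit_leb. y x = 0"
proof -
  obtain C where C: "\<forall>(y, h)\<in>L_nonlocal \<alpha> v. L2_norm y \<le> C * L2_norm (\<lambda>x. h x - z * y x)"
    using z unfolding spectrum_def resolvent_set_def by blast
  obtain h where h: "(y, h) \<in> L_nonlocal \<alpha> v" "AE x in unit_leb. h x = z * y x"
    using y by (auto simp: eigenspace_def)
  have "sq_int (\<lambda>x. h x - z * y x) = 0"
    unfolding sq_int_def by (rule integral_eq_zero_AE) (use h(2) in auto)
  then have "sqrt (sq_int y) \<le> 0"
    using bspec[OF C h(1)] by (simp add: L2_norm_eq)
  then have "sq_int y = 0" using sq_int_nonneg[of y] by simp
  then show ?thesis using sq_int_eq_0_iff[OF eigenspace_nonlocal_L2[OF y]] by simp
qed

lemma spectrum_mult_determines: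
  assumes eq: "spectrum_mult (L_nonlocal \<alpha> v) = spectrum_mult (L_nonlocal \<beta> w)" and n: "n \<ge> 1"
  shows "has_independent (L_nonlocal \<alpha> v) z n \<longleftrightarrow> has_independent (L_nonlocal \<beta> w) z n"
proof (cases "z \<in> spectrum (L_nonlocal \<alpha> v)")
  case True
  then have "(z, multiplicity_at (L_nonlocal \<alpha> v) z) \<in> spectrum_mult (L_nonlocal \<beta> w)"
    unfolding eq[symmetric] by (auto simp: spectrum_mult_def)
  then show ?thesis by (simp add: spectrum_mult_def flip: le_multiplicity_at_iff)
next
  case False
  have "z \<notin> spectrum (L_nonlocal \<beta> w)"
  proof
    assume "z \<in> spectrum (L_nonlocal \<beta> w)"
    then have "(z, multiplicity_at (L_nonlocal \<beta> w) z) \<in> spectrum_mult (L_nonlocal \<alpha> v)"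
      unfolding eq by (auto simp: spectrum_mult_def)
    then show False using False by (simp add: spectrum_mult_def)
  qed
  moreover have "\<not> has_independent (L_nonlocal \<gamma> u) z n" if "z \<notin> spectrum (L_nonlocal \<gamma> u)" for \<gamma> u
  proof
    assume "has_independent (L_nonlocal \<gamma> u) z n"
    then have "has_independent (L_nonlocal \<gamma> u) z 1"
      using L2_independent_mono[OF _ n] n unfolding has_independent_def by fastforce
    then show False
      using resolvent_no_eigenfunction[OF that] has_independent_1 by blast
  qed
  ultimately show ?thesis using False by blast
qed

text \<open>If the weight is nonzero, the relation at \<open>n = k\<close> gives
  \<open><y,v> = 0\<close>. Then all other coefficients of \<open>y\<close> vanish because the
  \<open>lam n\<close> are distinct, and \<open><y,v> = y_k * cnj v_k\<close> removes the last
  one.\<close>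

lemma eigenvalue_at_lam_iff:
  assumes v: "v \<in> L2"
  shows "has_independent (L_nonlocal \<alpha> v) (of_real (lam k)) 1 \<longleftrightarrow> \<alpha> * (cmod (fcoef v k))\<^sup>2 = 0"
  unfolding has_independent_1
proof
  assume "\<alpha> * (cmod (fcoef v k))\<^sup>2 = 0"
  then have "fmode k \<in> eigenspace (L_nonlocal \<alpha> v) (of_real (lam k))"
    by (intro fmode_eigenfunction[OF v]) auto
  moreover have "\<not> (AE x in unit_leb. fmode k x = 0)"
    using fcoef_zero_iff[OF fmode_L2, of k] fcoef_fmode[of k k] by fastforce
  ultimately show "\<exists>y\<in>eigenspace (L_nonlocal \<alpha> v) (of_real (lam k)). \<not> (AE x in unit_leb. y x = 0)" by blast
next
  assume "\<exists>y\<in>eigenspace (L_nonlocal \<alpha> v) (of_real (lam k)). \<not> (AE x in unit_leb. y x = 0)"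
  then obtain y where E: "y \<in> eigenspace (L_nonlocal \<alpha> v) (of_real (lam k))"
    and nz: "\<not> (AE x in unit_leb. y x = 0)" by blast
  have y: "y \<in> L2"
    and rel: "\<And>n. (of_real (lam n) - of_real (lam k)) * fcoef y n = - of_real \<alpha> * L2_inner y v * fcoef v n"
    using E unfolding eigenspace_nonlocal_iff[OF v] by auto
  show "\<alpha> * (cmod (fcoef v k))\<^sup>2 = 0"
  proof (rule ccontr)
    assume "\<alpha> * (cmod (fcoef v k))\<^sup>2 \<noteq> 0"
    then have ne: "\<alpha> \<noteq> 0" "fcoef v k \<noteq> 0" by auto
    then have c: "L2_inner y v = 0" using rel[of k] by simp
    have y0: "fcoef y n = 0" if "n \<noteq> k" for n
      using rel[of n] c that by (simp flip: of_real_diff)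
    have "fcoef y n = fcoef (\<lambda>x. fcoef y k * fmode k x) n" for n
      using y0[of n] by (cases "n = k") (auto simp: fcoef_scale fcoef_fmode)
    then have "AE x in unit_leb. y x = fcoef y k * fmode k x"
      by (intro fcoef_eq_imp_AE y L2_scale fmode_L2)
    then have "L2_inner y v = L2_inner (\<lambda>x. fcoef y k * fmode k x) v"
      by (intro L2_inner_cong_AE y L2_scale fmode_L2 v)
    also have "\<dots> = fcoef y k * cnj (fcoef v k)"
      unfolding L2_inner_scale_left using L2_inner_commute[of "fmode k" v] by (simp add: fcoef_def)
    finally have "fcoef y k = 0" using c ne by simp
    then have "fcoef y n = 0" for n using y0[of n] by (cases "n = k") auto
    then show False using nz fcoef_zero_iff[OF y] by blast
  qed
qed

text \<open>With \<open>b k = 0\<close> the mode \<open>fmode k\<close> is always an eigenfunction.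
  A two-dimensional eigenspace must contain a nonzero element without \<open>k\<close>-th
  coefficient, which is the kind of eigenfunction that zeros of \<open>char_fun b\<close>
  detect.\<close>

lemma double_eigenvalue_iff:
  assumes v: "v \<in> L2" and b: "\<And>n. b n = \<alpha> * (cmod (fcoef v n))\<^sup>2" and k: "b k = 0"
  shows "has_independent (L_nonlocal \<alpha> v) (of_real (lam k)) 2 \<longleftrightarrow> char_fun b (of_real (lam k)) = 0"
proof -
  define E where "E = eigenspace (L_nonlocal \<alpha> v) (of_real (lam k))"
  have E_L2: "y \<in> L2" if "y \<in> E" for y using that eigenspace_nonlocal_L2 by (simp add: E_def)
  have "\<alpha> * (cmod (fcoef v k))\<^sup>2 = 0" using k b by simp
  then have fk: "fmode k \<in> E" unfolding E_def by (intro fmode_eigenfunction[OF v]) auto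
  have "char_fun b (of_real (lam k)) = 0 \<longleftrightarrow>
      (\<exists>y\<in>E. \<not> (AE x in unit_leb. y x = 0) \<and> fcoef y k = 0)"
    using char_fun_zero_iff[OF v b, of "of_real (lam k)"] k unfolding E_def by auto
  also have "\<dots> \<longleftrightarrow> has_independent (L_nonlocal \<alpha> v) (of_real (lam k)) 2"
  proof
    assume "\<exists>y\<in>E. \<not> (AE x in unit_leb. y x = 0) \<and> fcoef y k = 0"
    then obtain y where y: "y \<in> E" "\<not> (AE x in unit_leb. y x = 0)" "fcoef y k = 0" by blast
    have "a = 0 \<and> c = 0" if ae: "AE x in unit_leb. a * fmode k x + c * y x = 0" for a c
    proof -
      have "(\<lambda>x. a * fmode k x + c * y x) \<in> L2" by (intro L2_add L2_scale fmode_L2 E_L2 y)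
      then have "fcoef (\<lambda>x. a * fmode k x + c * y x) n = 0" for n
        using ae fcoef_zero_iff by blast
      moreover have "fcoef (\<lambda>x. a * fmode k x + c * y x) n = a * fcoef (fmode k) n + c * fcoef y n" for n
        using E_L2[OF y(1)] by (subst fcoef_add) (auto intro: L2_scale fmode_L2 simp: fcoef_scale)
      ultimately have s: "a * fcoef (fmode k) n + c * fcoef y n = 0" for n by simp
      from s[of k] have a: "a = 0" using y(3) by (simp add: fcoef_fmode)
      then have "c * fcoef y n = 0" for n using s[of n] by simp
      then have "c = 0" using y(2) fcoef_zero_iff[OF E_L2[OF y(1)]] by auto
      then show ?thesis using a by simp
    qed
    then show "has_independent (L_nonlocal \<alpha> v) (of_real (lam k)) 2"
      unfolding has_independent_2 using fk y(1) E_def by blast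
  next
    assume "has_independent (L_nonlocal \<alpha> v) (of_real (lam k)) 2"
    then obtain y w where y: "y \<in> E" and w: "w \<in> E"
      and ind: "\<And>a c. (AE x in unit_leb. a * y x + c * w x = 0) \<Longrightarrow> a = 0 \<and> c = 0"
      unfolding has_independent_2 E_def by blast
    show "\<exists>y\<in>E. \<not> (AE x in unit_leb. y x = 0) \<and> fcoef y k = 0"
    proof (cases "fcoef w k = 0")
      case True
      then show ?thesis using w ind[of 0 1] by (intro bexI[of _ w]) auto
    next
      case False
      \<comment> \<open>This combination cancels the \<open>k\<close>-th coefficient; it is not null
        because the factor of \<open>y\<close> is nonzero and \<open>y\<close>, \<open>w\<close> are
        independent.\<close>
      define u where "u x = fcoef w k * y x + (- fcoef y k) * w x" for x
      have "u \<in> E" unfolding u_def E_def using y w by (intro eigenspace_nonlocal_lincomb v) (auto simp: E_def)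
      moreover have "fcoef u k = 0"
        unfolding u_def using E_L2[OF y] E_L2[OF w]
        by (subst fcoef_add) (auto intro: L2_scale L2_scale[of w "- fcoef y k", simplified] simp: fcoef_scale fcoef_scale[of "- fcoef y k" w, simplified])
      moreover have "\<not> (AE x in unit_leb. u x = 0)"
        using ind[of "fcoef w k" "- fcoef y k"] False unfolding u_def by blast
      ultimately show ?thesis by blast
    qed
  qed
  finally show ?thesis by blast
qed

text \<open>Multiplicity at least 1 at the \<open>lam n\<close> decides where the weights vanish.
  Zeros of the characteristic function show as multiplicity at least 2 at such points and at least 1
  elsewhere.\<close>

theorem spectrum_determines_weights:
  assumes v: "v \<in> L2" and w: "w \<in> L2"
    and eq: "spectrum_mult (L_nonlocal \<alpha> v) = spectrum_mult (L_nonlocal \<beta> w)"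
  shows "\<alpha> * (cmod (fcoef v n))\<^sup>2 = \<beta> * (cmod (fcoef w n))\<^sup>2"
proof -
  define b where "b n = \<alpha> * (cmod (fcoef v n))\<^sup>2" for n
  define c where "c n = \<beta> * (cmod (fcoef w n))\<^sup>2" for n
  have bs: "bounded_signed (\<lambda>n. \<gamma> * (cmod (fcoef u n))\<^sup>2)" if "u \<in> L2" for \<gamma> u
  proof -
    have "\<bar>\<gamma> * (cmod (fcoef u n))\<^sup>2\<bar> \<le> \<bar>\<gamma>\<bar> * sq_int u" for n
      using bessel_finite[OF that, of "{n}"] by (simp add: abs_mult mult_left_mono)
    moreover have "(\<forall>n. 0 \<le> \<gamma> * (cmod (fcoef u n))\<^sup>2) \<or> (\<forall>n. \<gamma> * (cmod (fcoef u n))\<^sup>2 \<le> 0)"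
      by (cases "\<gamma> \<ge> 0") (auto simp: mult_nonneg_nonneg mult_nonpos_nonneg)
    ultimately show ?thesis unfolding bounded_signed_def by blast
  qed
  have supp: "b n = 0 \<longleftrightarrow> c n = 0" for n
    using eigenvalue_at_lam_iff[OF v, of \<alpha> n] eigenvalue_at_lam_iff[OF w, of \<beta> n]
      spectrum_mult_determines[OF eq, of 1 "of_real (lam n)"] by (simp add: b_def c_def)
  have "b = c"
  proof (rule char_fun_determines[OF _ _ supp])
    show "bounded_signed b" "bounded_signed c" using bs v w by (auto simp: b_def[abs_def] c_def[abs_def])
    fix z :: complex assume z: "\<And>n. of_real (lam n) = z \<Longrightarrow> b n = 0"
    show "char_fun b z = 0 \<longleftrightarrow> char_fun c z = 0"
    proof (cases "\<exists>k. z = of_real (lam k)")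
      case True
      then obtain k where k: "z = of_real (lam k)" by blast
      show ?thesis
        using double_eigenvalue_iff[OF v b_def, of k] double_eigenvalue_iff[OF w c_def, of k] z[of k] supp[of k]
          spectrum_mult_determines[OF eq, of 2 z] unfolding k by simp
    next
      case False
      then have nz: "of_real (lam n) \<noteq> z" for n by auto
      have "char_fun b z = 0 \<longleftrightarrow> has_independent (L_nonlocal \<alpha> v) z 1"
        unfolding has_independent_1 by (subst char_fun_zero_iff[OF v b_def]) (use nz in auto)
      moreover have "char_fun c z = 0 \<longleftrightarrow> has_independent (L_nonlocal \<beta> w) z 1"
        unfolding has_independent_1 by (subst char_fun_zero_iff[OF w c_def]) (use nz in auto)
      ultimately show ?thesis using spectrum_mult_determines[OF eq, of 1 z] by simp
    qed
  qed
  then show ?thesis by (metis b_def c_def)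
qed

section \<open>The shift function and the recovery of the potential\<close>

lemma shift_fun_continuous: "continuous_on S shift_fun"
  unfolding shift_fun_def[abs_def] by (intro continuous_intros)

lemma shift_fun_L2: "shift_fun \<in> L2"
  by (intro L2_continuous shift_fun_continuous)

text \<open>The coefficients are \<open>1/2\<close> for \<open>n = 0\<close> and
  \<open>1 / (2 * pi * i * n)\<close> otherwise; the latter stem from the jump of the periodic
  extension.\<close>

lemma fcoef_shift_fun_nonzero: "fcoef shift_fun n \<noteq> 0"
proof (cases "n = 0")
  case True
  define F where "F x = complex_of_real (x - x\<^sup>2 / 2)" for x
  have "(F has_vector_derivative shift_fun x) (at x within {0..1})" for x
  proof -
    have "((\<lambda>x. x - x\<^sup>2 / 2) has_field_derivative (1 - x)) (at x within {0..1})"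
      by (auto intro!: derivative_eq_intros)
    then show ?thesis unfolding F_def shift_fun_def by (rule has_vector_derivative_of_real)
  qed
  then have "fcoef shift_fun n = F 1 - F 0"
    unfolding fcoef_eq True by (simp add: FTC_unit_leb shift_fun_continuous)
  also have "\<dots> = 1 / 2" by (simp add: F_def)
  finally have half: "fcoef shift_fun n = 1 / 2" .
  show ?thesis unfolding half by simp
next
  case False
  define c where "c = 2 * pi * \<i> * of_int (- n)"
  have c: "c \<noteq> 0" using False by (simp add: c_def)
  \<comment> \<open>The antiderivative found by one integration by parts.\<close>
  define F where "F x = shift_fun x * fmode (- n) x / c + fmode (- n) x / c\<^sup>2" for x
  have "(F has_vector_derivative shift_fun x * fmode (- n) x) (at x within {0..1})" for x
  proof -
    have e: "(fmode (- n) has_vector_derivative c * fmode (- n) x) (at x within {0..1})"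
      unfolding c_def by (rule fmode_deriv)
    have s: "(shift_fun has_vector_derivative - 1) (at x within {0..1})"
    proof -
      have "((\<lambda>x. 1 - x) has_field_derivative (-1)) (at x within {0..1})"
        by (auto intro!: derivative_eq_intros)
      from has_vector_derivative_of_real[OF this] show ?thesis
        unfolding shift_fun_def[abs_def] by simp
    qed
    have "(F has_vector_derivative (shift_fun x * (c * fmode (- n) x) + - 1 * fmode (- n) x) / c
        + c * fmode (- n) x / c\<^sup>2) (at x within {0..1})"
      unfolding F_def[abs_def]
      by (rule has_vector_derivative_add[OF
            has_vector_derivative_divide[OF has_vector_derivative_mult[OF s e]]
            has_vector_derivative_divide[OF e]])
    moreover have "(shift_fun x * (c * fmode (- n) x) + - 1 * fmode (- n) x) / c + c * fmode (- n) x / c\<^sup>2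
       = shift_fun x * fmode (- n) x"
      using c by (simp add: field_simps power2_eq_square)
    ultimately show ?thesis by simp
  qed
  then have "fcoef shift_fun n = F 1 - F 0"
    unfolding fcoef_eq by (intro FTC_unit_leb continuous_intros shift_fun_continuous fmode_continuous)
  also have "\<dots> = - 1 / c" by (simp add: F_def shift_fun_def)
  finally show ?thesis using c by simp
qed

text \<open>By polarization the shifts by \<open>g\<close> and \<open>i g\<close> fix the real and
  imaginary parts of \<open>v * cnj g\<close>. The equations below are the two parts of
  \<open>(v - w) * cnj g = 0\<close>, solved for \<open>v - w\<close>.\<close>

lemma complex_eq_of_norms:
  fixes v w g :: complex
  assumes g: "g \<noteq> 0" and n0: "(cmod v)\<^sup>2 = (cmod w)\<^sup>2" and n1: "(cmod (v + g))\<^sup>2 = (cmod (w + g))\<^sup>2"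
    and n2: "(cmod (v + \<i> * g))\<^sup>2 = (cmod (w + \<i> * g))\<^sup>2"
  shows "v = w"
proof -
  define a b s t where "a = Re v - Re w" "b = Im v - Im w" "s = Re g" "t = Im g"
  have 1: "a * s + b * t = 0"
    using n0 n1 unfolding cmod_power2 a_b_s_t_def by (simp add: power2_eq_square algebra_simps)
  have 2: "b * s - a * t = 0"
    using n0 n2 unfolding cmod_power2 a_b_s_t_def by (simp add: power2_eq_square algebra_simps)
  have st: "s\<^sup>2 + t\<^sup>2 \<noteq> 0" using g by (simp add: a_b_s_t_def complex_eq_iff sum_power2_eq_zero_iff)
  have "a * (s\<^sup>2 + t\<^sup>2) = s * (a * s + b * t) - t * (b * s - a * t)"
    by (simp add: power2_eq_square algebra_simps)
  then have "a * (s\<^sup>2 + t\<^sup>2) = 0" unfolding 1 2 by simp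
  then have "a = 0" using st unfolding mult_eq_0_iff by blast
  have "b * (s\<^sup>2 + t\<^sup>2) = t * (a * s + b * t) + s * (b * s - a * t)"
    by (simp add: power2_eq_square algebra_simps)
  then have "b * (s\<^sup>2 + t\<^sup>2) = 0" unfolding 1 2 by simp
  then have "b = 0" using st unfolding mult_eq_0_iff by blast
  show ?thesis using \<open>a = 0\<close> \<open>b = 0\<close> by (simp add: a_b_s_t_def complex_eq_iff)
qed

text \<open>For \<alpha> = 0 the operator is free whatever \<open>v\<close> is, so \<open>v\<close>
  can be claimed only for nonzero \<alpha>; then the weights are divided by \<alpha> and compared
  mode by mode.\<close>

theorem spectra_determine_potential:
  assumes v: "v \<in> L2" "L2_norm v = 1" and w: "w \<in> L2" "L2_norm w = 1"
    and s0: "spectrum_mult (L_nonlocal \<alpha> v) = spectrum_mult (L_nonlocal \<beta> w)"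
    and s1: "spectrum_mult (L_nonlocal \<alpha> (\<lambda>x. v x + shift_fun x)) = spectrum_mult (L_nonlocal \<beta> (\<lambda>x. w x + shift_fun x))"
    and s2: "spectrum_mult (L_nonlocal \<alpha> (\<lambda>x. v x + \<i> * shift_fun x)) = spectrum_mult (L_nonlocal \<beta> (\<lambda>x. w x + \<i> * shift_fun x))"
  shows "\<beta> = \<alpha> \<and> (\<alpha> \<noteq> 0 \<longrightarrow> (AE x in unit_leb. w x = v x))"
proof -
  have e0: "\<alpha> * (cmod (fcoef v n))\<^sup>2 = \<beta> * (cmod (fcoef w n))\<^sup>2" for n
    by (rule spectrum_determines_weights[OF v(1) w(1) s0])
  have e1: "\<alpha> * (cmod (fcoef v n + fcoef shift_fun n))\<^sup>2 = \<beta> * (cmod (fcoef w n + fcoef shift_fun n))\<^sup>2" for n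
    using spectrum_determines_weights[OF L2_add[OF v(1) shift_fun_L2] L2_add[OF w(1) shift_fun_L2] s1, of n]
    by (simp add: fcoef_add v w shift_fun_L2)
  have e2: "\<alpha> * (cmod (fcoef v n + \<i> * fcoef shift_fun n))\<^sup>2 = \<beta> * (cmod (fcoef w n + \<i> * fcoef shift_fun n))\<^sup>2" for n
    using spectrum_determines_weights[OF L2_add[OF v(1) L2_scale[OF shift_fun_L2]] L2_add[OF w(1) L2_scale[OF shift_fun_L2]] s2, of n]
    by (simp add: fcoef_add v w shift_fun_L2 L2_scale fcoef_scale)
  have "sq_int v = 1" "sq_int w = 1" using v(2) w(2) by (auto simp: L2_norm_eq)
  then have "((\<lambda>n. \<alpha> * (cmod (fcoef v n))\<^sup>2) has_sum \<alpha> * 1) UNIV" "((\<lambda>n. \<beta> * (cmod (fcoef w n))\<^sup>2) has_sum \<beta> * 1) UNIV"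
    using parseval[OF v(1)] parseval[OF w(1)] by (metis has_sum_cmult_right)+
  then have \<beta>: "\<beta> = \<alpha>" unfolding e0 using has_sum_unique by fastforce
  moreover have "AE x in unit_leb. w x = v x" if "\<alpha> \<noteq> 0"
  proof (rule fcoef_eq_imp_AE[OF w(1) v(1)])
    fix n show "fcoef w n = fcoef v n"
      using e0[of n] e1[of n] e2[of n] that unfolding \<beta>
      by (intro complex_eq_of_norms[OF fcoef_shift_fun_nonzero[of n]]) auto
  qed
  ultimately show ?thesis by blast
qed

theorem theorem5p5:
  shows "\<exists>recover :: (complex \<times> enat) set \<Rightarrow> (complex \<times> enat) set \<Rightarrow> (complex \<times> enat) set \<Rightarrow>
            (complex \<times> enat) set \<Rightarrow> real \<times> (real \<Rightarrow> complex).
    \<forall>(\<alpha> :: real) (v :: real \<Rightarrow> complex). v \<in> L2 \<longrightarrow> L2_norm v = 1 \<longrightarrow>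
      (case recover
          (spectrum_mult L_zero)
          (spectrum_mult (L_nonlocal \<alpha> v))
          (spectrum_mult (L_nonlocal \<alpha> (\<lambda>x. v x + shift_fun x)))
          (spectrum_mult (L_nonlocal \<alpha> (\<lambda>x. v x + \<i> * shift_fun x)))
        of (\<beta>, w) \<Rightarrow> \<beta> = \<alpha> \<and> (\<alpha> \<noteq> 0 \<longrightarrow> (AE x in unit_leb. w x = v x)))"
proof -
  \<comment> \<open>Recovery picks any normalized potential that is consistent with the given
    spectra. One exists, namely the original potential, and uniqueness identifies whatever was
    picked with it.\<close>
  define P where "P S1 S2 S3 p \<longleftrightarrow> snd p \<in> L2 \<and> L2_norm (snd p) = 1 \<and>
      S1 = spectrum_mult (L_nonlocal (fst p) (snd p)) \<and>
      S2 = spectrum_mult (L_nonlocal (fst p) (\<lambda>x. snd p x + shift_fun x)) \<and>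
      S3 = spectrum_mult (L_nonlocal (fst p) (\<lambda>x. snd p x + \<i> * shift_fun x))"
    for S1 S2 S3 and p :: "real \<times> (real \<Rightarrow> complex)"
  show ?thesis
  proof (intro exI[of _ "\<lambda>S0 S1 S2 S3. SOME p. P S1 S2 S3 p"] allI impI)
    fix \<alpha> :: real and v :: "real \<Rightarrow> complex"
    assume v: "v \<in> L2" "L2_norm v = 1"
    let ?p = "SOME p. P (spectrum_mult (L_nonlocal \<alpha> v)) (spectrum_mult (L_nonlocal \<alpha> (\<lambda>x. v x + shift_fun x)))
          (spectrum_mult (L_nonlocal \<alpha> (\<lambda>x. v x + \<i> * shift_fun x))) p"
    have "P (spectrum_mult (L_nonlocal \<alpha> v)) (spectrum_mult (L_nonlocal \<alpha> (\<lambda>x. v x + shift_fun x)))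
          (spectrum_mult (L_nonlocal \<alpha> (\<lambda>x. v x + \<i> * shift_fun x))) ?p"
      by (rule someI[of _ "(\<alpha>, v)"]) (simp add: P_def v)
    then show "case ?p of (\<beta>, w) \<Rightarrow> \<beta> = \<alpha> \<and> (\<alpha> \<noteq> 0 \<longrightarrow> (AE x in unit_leb. w x = v x))"
      unfolding P_def case_prod_beta using v by (intro spectra_determine_potential) auto
  qed
qed

end
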